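(* Let $P\subset\mathbb{R}^d$ be a generic orthotope of dimension $d$ and let $0\le k\le d$. Then every face of $P$ of dimension $k$ is a generic orthotope of dimension $k$.
   Context: **Floral vertices.** A series-parallel diagram (SPD) $\Delta$ with finite nonempty edge set $E$ is either a single edge, or a series connection $\Delta_1\wedge\Delta_2$, or a parallel connection $\Delta_1\vee\Delta_2$, of SPDs with disjoint nonempty edge sets whose union is $E$ (a read-once formula in $\wedge,\vee$). The single vertex is admitted as an SPD with no edges. A signed SPD is a pair $(\Delta,s)$ with $s:E\to\{\pm1\}$. Let $H_i=\{x\in\mathbb{R}^d: x_i\ge 0\}$. If $E=\{1,\dots,d\}$, the floral vertex in $\mathbb{R}^d$ determined by $(\Delta,s)$ is the set obtained by interpreting edge $i$ as $s_iH_i$, series connection as intersection and parallel connection as union. (For $d=0$, the floral vertex is the point $\mathbb{R}^0$.) **Orthogonal polytopes.** An axis-aligned box is a product $\prod_{i=1}^d[a_i,b_i]$, $a_i\le b_i$; it is pure $d$-dimensional if all $a_i<b_i$. A pure $d$-dimensional orthogonal polytope is a finite (possibly empty) union of pure $d$-dimensional boxes. For $s\in\{\pm1\}^d$ the orthant $\Omega_s$ is $\{x: s_ix_i\ge0\ \forall i\}$; a local orthotopal arrangement is a union of orthants. The tangent cone of $P$ at $v\in P$ is the local orthotopal arrangement $\alpha$ such that for some $\delta>0$, $P\cap(v+[-\delta,\delta]^d)=v+(\alpha\cap[-\delta,\delta]^d)$. A generalized hyperplane is a set $\Pi_{I,\lambda}=\{x\in\mathbb{R}^d:x_i=\lambda(i)\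 \forall i\in I\}$ with $I\subset\{1,\dots,d\}$, $\lambda:I\to\mathbb{R}$; it is identified with $\mathbb{R}^{d-|I|}$ by forgetting the coordinates in $I$. The genericity region of $v\in P$ is the set of points of $P$ joined to $v$ by a path in $P$ along which every tangent cone is congruent (under signed coordinate permutations) to the one at $v$. Its degree is the smallest dimension of a generalized hyperplane containing it. A point is singular (a vertex of $P$) if its genericity region has degree $0$. A $k$-dimensional face of $P$ is the closure of a genericity region of degree $k$; it lies in a generalized hyperplane of dimension $k$, and is regarded as a subset of $\mathbb{R}^k$ via the identification above. **Generic orthotope.** A generic orthotope of dimension $d$ is a pure $d$-dimensional orthogonal polytope in $\mathbb{R}^d$ such that the tangent cone at every singular point is a floral vertex in $\mathbb{R}^d$ (on $d$ half-spaces). *)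

theory Defs
  imports "HOL-Analysis.Analysis"
begin

text \<open>
  The dimension has to be an ordinary natural number, with 0 allowed, so a point of
  \<open>\<real>\<^sup>d\<close> is a function \<open>nat \<Rightarrow> real\<close> that vanishes from index \<open>d\<close> on; the coordinates are
  numbered \<open>0, \<dots>, d - 1\<close>. Paths and closures are those of the product topology on
  \<open>nat \<Rightarrow> real\<close>. It induces the Euclidean topology on \<open>\<real>\<^sup>d\<close>, which is a closed subset.
\<close>

definition Rn :: "nat \<Rightarrow> (nat \<Rightarrow> real) set" where
  "Rn d = {x. \<forall>i\<ge>d. x i = 0}"

definition signs :: "nat \<Rightarrow> (nat \<Rightarrow> real) \<Rightarrow> bool" where
  "signs d s \<longleftrightarrow> (\<forall>i<d. s i = 1 \<or> s i = -1)"

definition translate :: "(nat \<Rightarrow> real) \<Rightarrow> (nat \<Rightarrow> real) set \<Rightarrow> (nat \<Rightarrow> real) set" where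
  "translate v A = (\<lambda>x i. v i + x i) ` A"


subsection \<open>Floral vertices\<close>

datatype (edges: 'e) spd =
    Vertex
  | Edge 'e
  | Series "'e spd" "'e spd"
  | Parallel "'e spd" "'e spd"

text \<open>
  The datatype alone permits repeated edges and \<open>Vertex\<close> inside a compound diagram.
  Both are excluded here, so \<open>Vertex\<close> is only an SPD on its own.
\<close>

fun is_spd :: "'e spd \<Rightarrow> bool" where
  "is_spd Vertex \<longleftrightarrow> True"
| "is_spd (Edge e) \<longleftrightarrow> True"
| "is_spd (Series D1 D2) \<longleftrightarrow> is_spd D1 \<and> is_spd D2 \<and>
     edges D1 \<noteq> {} \<and> edges D2 \<noteq> {} \<and> edges D1 \<inter> edges D2 = {}"
| "is_spd (Parallel D1 D2) \<longleftrightarrow> is_spd D1 \<and> is_spd D2 \<and>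
     edges D1 \<noteq> {} \<and> edges D2 \<noteq> {} \<and> edges D1 \<inter> edges D2 = {}"

definition half_space :: "nat \<Rightarrow> nat \<Rightarrow> (nat \<Rightarrow> real) set" where
  "half_space d i = {x \<in> Rn d. x i \<ge> 0}"

text \<open>In a floral vertex the case \<open>Vertex\<close> arises only for \<open>d = 0\<close>, where \<open>Rn 0\<close> is a point.\<close>

fun interpret_spd :: "nat \<Rightarrow> (nat \<Rightarrow> real) \<Rightarrow> nat spd \<Rightarrow> (nat \<Rightarrow> real) set" where
  "interpret_spd d s Vertex = Rn d"
| "interpret_spd d s (Edge i) = (\<lambda>x j. s i * x j) ` half_space d i"
| "interpret_spd d s (Series D1 D2) = interpret_spd d s D1 \<inter> interpret_spd d s D2"
| "interpret_spd d s (Parallel D1 D2) = interpret_spd d s D1 \<union> interpret_spd d s D2"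

definition floral_vertex :: "nat \<Rightarrow> (nat \<Rightarrow> real) set \<Rightarrow> bool" where
  "floral_vertex d A \<longleftrightarrow>
     (\<exists>D s. is_spd D \<and> edges D = {..<d} \<and> signs d s \<and> A = interpret_spd d s D)"


subsection \<open>Orthogonal polytopes and tangent cones\<close>

definition aabox :: "nat \<Rightarrow> (nat \<Rightarrow> real) \<Rightarrow> (nat \<Rightarrow> real) \<Rightarrow> (nat \<Rightarrow> real) set" where
  "aabox d a b = {x \<in> Rn d. \<forall>i<d. a i \<le> x i \<and> x i \<le> b i}"

definition pure_box :: "nat \<Rightarrow> (nat \<Rightarrow> real) set \<Rightarrow> bool" where
  "pure_box d B \<longleftrightarrow> (\<exists>a b. (\<forall>i<d. a i < b i) \<and> B = aabox d a b)"

definition pure_orthogonal_polytope :: "nat \<Rightarrow> (nat \<Rightarrow> real) set \<Rightarrow> bool" where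
  "pure_orthogonal_polytope d P \<longleftrightarrow>
     (\<exists>\<B>. finite \<B> \<and> (\<forall>B\<in>\<B>. pure_box d B) \<and> P = \<Union>\<B>)"

definition orthant :: "nat \<Rightarrow> (nat \<Rightarrow> real) \<Rightarrow> (nat \<Rightarrow> real) set" where
  "orthant d s = {x \<in> Rn d. \<forall>i<d. s i * x i \<ge> 0}"

definition local_arrangement :: "nat \<Rightarrow> (nat \<Rightarrow> real) set \<Rightarrow> bool" where
  "local_arrangement d A \<longleftrightarrow> (\<exists>S. (\<forall>s\<in>S. signs d s) \<and> A = \<Union>(orthant d ` S))"

definition cube :: "nat \<Rightarrow> real \<Rightarrow> (nat \<Rightarrow> real) set" where
  "cube d \<delta> = aabox d (\<lambda>_. - \<delta>) (\<lambda>_. \<delta>)"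

definition tangent_cone :: "nat \<Rightarrow> (nat \<Rightarrow> real) set \<Rightarrow> (nat \<Rightarrow> real) \<Rightarrow> (nat \<Rightarrow> real) set" where
  "tangent_cone d P v = (THE A. local_arrangement d A \<and>
     (\<exists>\<delta>>0. P \<inter> translate v (cube d \<delta>) = translate v (A \<inter> cube d \<delta>)))"

definition congruent_cones :: "nat \<Rightarrow> (nat \<Rightarrow> real) set \<Rightarrow> (nat \<Rightarrow> real) set \<Rightarrow> bool" where
  "congruent_cones d A B \<longleftrightarrow>
     (\<exists>\<sigma> s. \<sigma> permutes {..<d} \<and> signs d s \<and> B = (\<lambda>x i. s i * x (\<sigma> i)) ` A)"


subsection \<open>Genericity regions and faces\<close>

definition gen_hyperplane :: "nat \<Rightarrow> nat set \<Rightarrow> (nat \<Rightarrow> real) \<Rightarrow> (nat \<Rightarrow> real) set" where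
  "gen_hyperplane d I l = {x \<in> Rn d. \<forall>i\<in>I. x i = l i}"

text \<open>
  Forgetting the coordinates in \<open>I\<close>: the remaining ones are renumbered increasingly from 0,
  so the result lies in \<open>Rn (card ({..<d} - I))\<close>.
\<close>

definition forget :: "nat \<Rightarrow> nat set \<Rightarrow> (nat \<Rightarrow> real) \<Rightarrow> (nat \<Rightarrow> real)" where
  "forget d I x = (\<lambda>j. if j < card ({..<d} - I)
                       then x (sorted_list_of_set ({..<d} - I) ! j) else 0)"

definition genericity_region :: "nat \<Rightarrow> (nat \<Rightarrow> real) set \<Rightarrow> (nat \<Rightarrow> real) \<Rightarrow> (nat \<Rightarrow> real) set" where
  "genericity_region d P v = {w \<in> P. \<exists>g. path g \<and> path_image g \<subseteq> P \<and>
     pathstart g = v \<and> pathfinish g = w \<and>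
     (\<forall>x\<in>path_image g. congruent_cones d (tangent_cone d P x) (tangent_cone d P v))}"

definition region_degree :: "nat \<Rightarrow> (nat \<Rightarrow> real) set \<Rightarrow> nat" where
  "region_degree d R = (LEAST m. \<exists>I l. I \<subseteq> {..<d} \<and> m = d - card I \<and> R \<subseteq> gen_hyperplane d I l)"

definition singular_point :: "nat \<Rightarrow> (nat \<Rightarrow> real) set \<Rightarrow> (nat \<Rightarrow> real) \<Rightarrow> bool" where
  "singular_point d P v \<longleftrightarrow> v \<in> P \<and> region_degree d (genericity_region d P v) = 0"

definition polytope_face :: "nat \<Rightarrow> (nat \<Rightarrow> real) set \<Rightarrow> nat \<Rightarrow> (nat \<Rightarrow> real) set \<Rightarrow> bool" where
  "polytope_face d P k F \<longleftrightarrow> (\<exists>v\<in>P. region_degree d (genericity_region d P v) = k \<and>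
     F = closure (genericity_region d P v))"

definition generic_orthotope :: "nat \<Rightarrow> (nat \<Rightarrow> real) set \<Rightarrow> bool" where
  "generic_orthotope d P \<longleftrightarrow> pure_orthogonal_polytope d P \<and>
     (\<forall>v. singular_point d P v \<longrightarrow> floral_vertex d (tangent_cone d P v))"

lemma closed_gen_hyperplane: "closed (gen_hyperplane d I l)"
proof -
  have c: "closed {x :: nat \<Rightarrow> real. x i = c}" for i c
    by (intro closed_Collect_eq continuous_on_product_coordinates continuous_on_const)
  have "gen_hyperplane d I l =
      (\<Inter>i\<in>{d..}. {x. x i = 0}) \<inter> (\<Inter>i\<in>I. {x. x i = l i})"
    unfolding gen_hyperplane_def Rn_def by auto
  then show ?thesis
    by (simp only:) (intro closed_Int closed_INT ballI c)
qed

text \<open>A \<open>k\<close>-dimensional face does lie in a \<open>k\<close>-dimensional generalized hyperplane.\<close>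

lemma polytope_face_in_gen_hyperplane:
  assumes "pure_orthogonal_polytope d P" and "polytope_face d P k F"
  shows "\<exists>I l. I \<subseteq> {..<d} \<and> d - card I = k \<and> F \<subseteq> gen_hyperplane d I l"
proof -
  from assms(2) obtain v where
    k: "region_degree d (genericity_region d P v) = k" and
    F: "F = closure (genericity_region d P v)"
    unfolding polytope_face_def by blast
  let ?R = "genericity_region d P v"
  let ?Q = "\<lambda>m. \<exists>I l. I \<subseteq> {..<d} \<and> m = d - card I \<and> ?R \<subseteq> gen_hyperplane d I l"
  have "P \<subseteq> Rn d"
    using assms(1) unfolding pure_orthogonal_polytope_def pure_box_def aabox_def by blast
  then have "?R \<subseteq> gen_hyperplane d {} (\<lambda>_. 0)"
    unfolding genericity_region_def gen_hyperplane_def by auto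
  then have "?Q d"
    by (intro exI[of _ "{}"] exI[of _ "\<lambda>_. 0"]) simp
  then have "?Q (LEAST m. ?Q m)"
    by (rule LeastI)
  then have "?Q k"
    using k unfolding region_degree_def by simp
  then obtain I l where Il: "I \<subseteq> {..<d}" "k = d - card I" "?R \<subseteq> gen_hyperplane d I l"
    by blast
  have "F \<subseteq> gen_hyperplane d I l"
    unfolding F by (rule closure_minimal[OF Il(3) closed_gen_hyperplane])
  with Il show ?thesis
    by blast
qed

end

theory Submission
  imports Defs
begin

text \<open>
  A local arrangement of orthants is encoded by a Boolean function \<open>f\<close> of \<open>d\<close> signs, and the tangent
  cone at a nearby point arises by substituting the signs of the displacement into \<open>f\<close>. Congruent
  cones depend on equally many signs, so along a genericity region the function is constant and the
  coordinates it depends on are frozen: these are exactly the set \<open>I\<close>.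

  Floral vertices are the read-once functions. Every tangent cone of a generic orthotope is read-once
  or the whole space, since it is a restriction of the cone at a vertex. If \<open>w\<close> lies in the closure of
  the region of \<open>v\<close>, the face near \<open>w\<close> is the cone of those signs \<open>t\<close> of the free coordinates for which
  \<open>f\<^sub>w(\<cdot>, t) = f\<^sub>v\<close>. By recursion on the diagram, this condition on \<open>t\<close> is again read-once: a factor
  containing a variable of \<open>I\<close> must restrict to the corresponding factor of \<open>f\<^sub>v\<close>, and a factor
  without such a variable must take the neutral value.
\<close>

subsection \<open>Boolean functions and their restrictions\<close>

text \<open>A face is the closure of a path component, so neither a decomposition into boxes nor its
  local shape comes for free. Boxes are avoided by a criterion: the finite unions of
  full-dimensional boxes are exactly the compact sets that look like a union of orthants near each
  of their points, and this can be checked for the closure of a region. Locally two things could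
  fail. The condition on the free signs might not be read-once; here it matters that every sign in
  \<open>I\<close> stays essential once the free signs are fixed, since this keeps the factors
  containing such signs nonconstant and lets each factor be recovered from the compound. And the
  points satisfying the condition might fall into several pieces of which the region is only one;
  monotonicity of read-once functions towards a common centre connects them. The constant True has
  to be carried along throughout: it belongs to interior points, and it is the floral vertex of
  dimension 0.\<close>

definition reads :: "'i set \<Rightarrow> (('i \<Rightarrow> bool) \<Rightarrow> bool) \<Rightarrow> bool" where
  "reads A f \<longleftrightarrow> (\<forall>b b'. (\<forall>i\<in>A. b i = b' i) \<longrightarrow> f b = f b')"

definition dep :: "(('i \<Rightarrow> bool) \<Rightarrow> bool) \<Rightarrow> 'i set" where
  "dep f = {i. \<exists>b. f (b(i := True)) \<noteq> f (b(i := False))}"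

lemma readsD: "reads A f \<Longrightarrow> (\<And>i. i \<in> A \<Longrightarrow> b i = b' i) \<Longrightarrow> f b = f b'"
  unfolding reads_def by blast

lemma dep_subset:
  assumes "reads A f" shows "dep f \<subseteq> A"
proof
  fix i assume "i \<in> dep f"
  then obtain b where b: "f (b(i := True)) \<noteq> f (b(i := False))" unfolding dep_def by blast
  show "i \<in> A"
  proof (rule ccontr)
    assume "i \<notin> A"
    then have "f (b(i := True)) = f (b(i := False))" by (intro readsD[OF assms]) auto
    with b show False by simp
  qed
qed

lemma not_depD:
  assumes "i \<notin> dep f" shows "f (b(i := x)) = f b"
proof -
  have "f (b(i := True)) = f (b(i := False))" using assms unfolding dep_def by blast
  moreover have "b(i := b i) = b" by simp
  ultimately show ?thesis by (metis (full_types))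
qed

text \<open>Values outside \<open>dep f\<close> can be exchanged one at a time, in finitely many
  steps. The condition that infinitely many signs are True has no essential variable and yet is not
  constant, so finiteness of \<open>A\<close> matters.\<close>

lemma reads_dep:
  assumes "reads A f" "finite A" shows "reads (dep f) f"
proof -
  have *: "f b = f (override_on b b' B)" if "finite B" "\<forall>i\<in>dep f. b i = b' i" for b b' B
    using that(1)
  proof (induction B)
    case (insert i B)
    have "override_on b b' (insert i B) = (override_on b b' B)(i := b' i)"
      by (auto simp: override_on_def fun_eq_iff)
    moreover have "f ((override_on b b' B)(i := b' i)) = f (override_on b b' B)"
    proof (cases "i \<in> dep f")
      case True
      then have "(override_on b b' B)(i := b' i) = override_on b b' B"
        using that(2) insert.hyps by (auto simp: override_on_def fun_eq_iff)
      then show ?thesis by simp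
    qed (rule not_depD)
    ultimately show ?case using insert.IH by metis
  qed simp
  have "f b = f b'" if "\<forall>i\<in>dep f. b i = b' i" for b b'
  proof -
    have "f b = f (override_on b b' A)" by (rule *[OF assms(2) that])
    also have "\<dots> = f b'" by (rule readsD[OF assms(1)]) (simp add: override_on_def)
    finally show ?thesis .
  qed
  then show ?thesis unfolding reads_def by blast
qed

text \<open>Zero coordinates of \<open>y\<close> stay free: as \<open>b\<close> varies,
  \<open>signfix y b\<close> runs through the sign vectors of the orthants that contain
  \<open>y\<close>.\<close>

definition signfix :: "('i \<Rightarrow> real) \<Rightarrow> ('i \<Rightarrow> bool) \<Rightarrow> 'i \<Rightarrow> bool" where
  "signfix y b = (\<lambda>i. y i > 0 \<or> (y i = 0 \<and> b i))"

definition restr :: "('i \<Rightarrow> real) \<Rightarrow> (('i \<Rightarrow> bool) \<Rightarrow> bool) \<Rightarrow> ('i \<Rightarrow> bool) \<Rightarrow> bool" where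
  "restr y f = (\<lambda>b. f (signfix y b))"

lemma reads_restr: "reads A f \<Longrightarrow> reads A (restr y f)"
  unfolding reads_def restr_def signfix_def by simp

lemma dep_restr: "dep (restr y f) \<subseteq> dep f \<inter> {i. y i = 0}"
proof
  fix i assume "i \<in> dep (restr y f)"
  then obtain b where b: "f (signfix y (b(i := True))) \<noteq> f (signfix y (b(i := False)))"
    unfolding dep_def restr_def by blast
  have y: "y i = 0"
  proof (rule ccontr)
    assume "y i \<noteq> 0"
    then have "signfix y (b(i := True)) = signfix y (b(i := False))" by (auto simp: signfix_def)
    with b show False by simp
  qed
  then have "signfix y (b(i := x)) = (signfix y b)(i := x)" for x by (auto simp: signfix_def)
  with b have "i \<in> dep f" unfolding dep_def by auto
  with y show "i \<in> dep f \<inter> {i. y i = 0}" by simp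
qed

lemma restr_cong:
  assumes "reads (dep f) f" "\<And>i. i \<in> dep f \<Longrightarrow> y i = z i"
  shows "restr y f = restr z f"
  unfolding restr_def by (intro ext readsD[OF assms(1)]) (simp add: signfix_def assms(2))

lemma restr_eq:
  assumes "reads (dep f) f" "\<And>i. i \<in> dep f \<Longrightarrow> y i = 0"
  shows "restr y f = f"
  unfolding restr_def by (intro ext readsD[OF assms(1)]) (simp add: signfix_def assms(2))

text \<open>Substitution can only destroy essential variables (\<open>dep_restr\<close>). If their
  number does not drop, no essential sign was substituted. This turns congruence of cones along a
  path into equality.\<close>

lemma restr_eq_if_card_dep:
  assumes "reads A f" "finite A" "card (dep (restr y f)) = card (dep f)"
  shows "restr y f = f" "\<And>i. i \<in> dep f \<Longrightarrow> y i = 0"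
proof -
  have "finite (dep f)" using dep_subset[OF assms(1)] assms(2) finite_subset by blast
  then have "dep (restr y f) = dep f"
    using dep_restr[of y f] assms(3) by (intro card_subset_eq) auto
  then show z: "\<And>i. i \<in> dep f \<Longrightarrow> y i = 0" using dep_restr[of y f] by blast
  show "restr y f = f" by (rule restr_eq[OF reads_dep[OF assms(1,2)] z])
qed

subsection \<open>Read-once functions\<close>

text \<open>These are the functions of signed diagrams, where leaf \<open>i\<close> asks for the
  sign \<open>c i\<close>. Keeping \<open>c\<close> as one global parameter exhibits a centre at
  which all leaves hold. Index sets are never empty, so constants are excluded.\<close>

inductive read_once :: "('i \<Rightarrow> bool) \<Rightarrow> 'i set \<Rightarrow> (('i \<Rightarrow> bool) \<Rightarrow> bool) \<Rightarrow> bool" for c where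
  lit: "read_once c {i} (\<lambda>b. b i = c i)"
| conj: "read_once c A f \<Longrightarrow> read_once c B g \<Longrightarrow> A \<inter> B = {} \<Longrightarrow>
    read_once c (A \<union> B) (\<lambda>b. f b \<and> g b)"
| disj: "read_once c A f \<Longrightarrow> read_once c B g \<Longrightarrow> A \<inter> B = {} \<Longrightarrow>
    read_once c (A \<union> B) (\<lambda>b. f b \<or> g b)"

lemma read_once_nonempty: "read_once c A f \<Longrightarrow> A \<noteq> {}"
  by (induction rule: read_once.induct) auto

lemma read_once_reads: "read_once c A f \<Longrightarrow> reads A f"
proof (induction rule: read_once.induct)
  case (lit i)
  then show ?case unfolding reads_def by simp
next
  case (conj A f B g)
  show ?case unfolding reads_def
    using readsD[OF conj.IH(1)] readsD[OF conj.IH(2)] by (metis UnCI)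
next
  case (disj A f B g)
  show ?case unfolding reads_def
    using readsD[OF disj.IH(1)] readsD[OF disj.IH(2)] by (metis UnCI)
qed

lemma read_once_center: "read_once c A f \<Longrightarrow> f c"
  by (induction rule: read_once.induct) auto

text \<open>Moving a sign to that of the centre can only make its leaf true, and the connectives are
  monotone.\<close>

lemma read_once_monotone:
  "read_once c A f \<Longrightarrow> f b \<Longrightarrow> (\<And>i. i \<in> A \<Longrightarrow> b' i \<noteq> b i \<Longrightarrow> b' i = c i) \<Longrightarrow> f b'"
proof (induction rule: read_once.induct)
  case (lit i) then show ?case by auto
next
  case (conj A f B g) then show ?case by blast
next
  case (disj A f B g) then show ?case by blast
qed

lemma read_once_cong_center:
  assumes "read_once c A f" "\<And>i. i \<in> A \<Longrightarrow> c i = c' i"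
  shows "read_once c' A f"
  using assms
proof (induction rule: read_once.induct)
  case (lit i)
  then show ?case using read_once.lit[of c' i] by simp
qed (auto intro: read_once.intros)

text \<open>Different centres do no harm: they matter only on disjoint sets and can be
  glued.\<close>

lemma read_once_conj:
  assumes "read_once c A f" "read_once c' B g" "A \<inter> B = {}"
  shows "\<exists>c''. read_once c'' (A \<union> B) (\<lambda>b. f b \<and> g b)"
proof -
  let ?c = "override_on c' c A"
  have "read_once ?c A f" by (rule read_once_cong_center[OF assms(1)]) simp
  moreover have "read_once ?c B g"
    by (rule read_once_cong_center[OF assms(2)]) (use assms(3) in \<open>auto simp: override_on_def\<close>)
  ultimately show ?thesis using read_once.conj assms(3) by blast
qed

text \<open>De Morgan: negation flips the leaves and exchanges the two connectives.\<close>

lemma read_once_not: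
  "read_once c A f \<Longrightarrow> read_once (\<lambda>i. \<not> c i) A (\<lambda>b. \<not> f b)"
proof (induction rule: read_once.induct)
  case (lit i)
  then show ?case using read_once.lit[of "\<lambda>i. \<not> c i" i] by simp
next
  case (conj A f B g)
  then show ?case using read_once.disj[OF conj.IH] by simp
next
  case (disj A f B g)
  then show ?case using read_once.conj[OF disj.IH] by simp
qed

text \<open>Serves to renumber the free coordinates of a face.\<close>

lemma read_once_reindex:
  assumes "read_once c A f" "inj_on p A"
  shows "read_once (\<lambda>j. c (inv_into A p j)) (p ` A) (\<lambda>b. f (\<lambda>i. b (p i)))"
proof -
  define c' where "c' = (\<lambda>j. c (inv_into A p j))"
  have "i \<in> A \<Longrightarrow> c' (p i) = c i" for i unfolding c'_def using assms(2) by simp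
  with assms have "read_once c' (p ` A) (\<lambda>b. f (\<lambda>i. b (p i)))"
  proof (induction rule: read_once.induct)
    case (lit i)
    then show ?case using read_once.lit[of c' "p i"] by simp
  next
    case (conj A f B g)
    have "p ` A \<inter> p ` B = {}"
      using conj.hyps(3) conj.prems(1) inj_on_image_Int[of p "A \<union> B" A B] by simp
    then show ?case unfolding image_Un using conj.prems
      by (intro read_once.conj conj.IH) (auto simp: inj_on_Un)
  next
    case (disj A f B g)
    have "p ` A \<inter> p ` B = {}"
      using disj.hyps(3) disj.prems(1) inj_on_image_Int[of p "A \<union> B" A B] by simp
    then show ?case unfolding image_Un using disj.prems
      by (intro read_once.disj disj.IH) (auto simp: inj_on_Un)
  qed
  then show ?thesis unfolding c'_def .
qed

text \<open>A substituted leaf becomes a constant, which either drops out of its compound or absorbs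
  it. What survives is read-once with the same centre.\<close>

lemma read_once_restr:
  "read_once c A f \<Longrightarrow>
     (\<exists>t. restr y f = (\<lambda>_. t)) \<or> (\<exists>A'\<subseteq>A. read_once c A' (restr y f))"
proof (induction rule: read_once.induct)
  case (lit i)
  then show ?case
    using read_once.lit[of c i] by (cases "y i = 0") (auto simp: restr_def signfix_def)
next
  case (conj A f B g)
  have "restr y (\<lambda>b. f b \<and> g b) = (\<lambda>b. restr y f b \<and> restr y g b)" by (simp add: restr_def)
  moreover have "\<exists>C\<subseteq>A \<union> B. read_once c C (\<lambda>b. restr y f b \<and> restr y g b)"
    if "A' \<subseteq> A" "B' \<subseteq> B" "read_once c A' (restr y f)" "read_once c B' (restr y g)" for A' B'
    using read_once.conj[OF that(3,4)] that(1,2) conj.hyps(3) by (intro exI[of _ "A' \<union> B'"]) auto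
  moreover have ?case if "restr y f = (\<lambda>_. t)" for t
    using that conj.IH(2) calculation(1) by (cases t) auto
  moreover have ?case if "restr y g = (\<lambda>_. t)" for t
    using that conj.IH(1) calculation(1) by (cases t) auto
  ultimately show ?case using conj.IH by metis
next
  case (disj A f B g)
  have "restr y (\<lambda>b. f b \<or> g b) = (\<lambda>b. restr y f b \<or> restr y g b)" by (simp add: restr_def)
  moreover have "\<exists>C\<subseteq>A \<union> B. read_once c C (\<lambda>b. restr y f b \<or> restr y g b)"
    if "A' \<subseteq> A" "B' \<subseteq> B" "read_once c A' (restr y f)" "read_once c B' (restr y g)" for A' B'
    using read_once.disj[OF that(3,4)] that(1,2) disj.hyps(3) by (intro exI[of _ "A' \<union> B'"]) auto
  moreover have ?case if "restr y f = (\<lambda>_. t)" for t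
    using that disj.IH(2) calculation(1) by (cases t) auto
  moreover have ?case if "restr y g = (\<lambda>_. t)" for t
    using that disj.IH(1) calculation(1) by (cases t) auto
  ultimately show ?case using disj.IH by metis
qed

section \<open>Essential variables of a read-once function\<close>

lemma dep_subset_dep_conj:
  assumes "reads A f" "reads B g" "A \<inter> B = {}" "g b0"
  shows "dep f \<subseteq> dep (\<lambda>b. f b \<and> g b)"
proof
  fix i assume i: "i \<in> dep f"
  then have iA: "i \<in> A" using dep_subset[OF assms(1)] by blast
  from i obtain b where b: "f (b(i := True)) \<noteq> f (b(i := False))" unfolding dep_def by blast
  let ?b = "override_on b0 b A"
  have "f (?b(i := x)) = f (b(i := x))" for x
    by (rule readsD[OF assms(1)]) (simp add: override_on_def)
  moreover have "g (?b(i := x)) = g b0" for x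
    by (rule readsD[OF assms(2)]) (use assms(3) iA in \<open>auto simp: override_on_def\<close>)
  ultimately show "i \<in> dep (\<lambda>b. f b \<and> g b)"
    unfolding dep_def using b assms(4) by blast
qed

lemma dep_not: "dep (\<lambda>b. \<not> f b) = dep f"
  unfolding dep_def by auto

text \<open>Each leaf can be made decisive, because the other factor of a compound shares no
  variable with it and can be set to its neutral value. Disjunctions reduce to conjunctions by
  negation. Consequently \<open>f\<close> determines \<open>A\<close>.\<close>

lemma read_once_dep: "read_once c A f \<Longrightarrow> dep f = A"
proof (induction rule: read_once.induct)
  case (lit i)
  then show ?case by (auto simp: dep_def split: if_splits)
next
  case (conj A f B g)
  note r = read_once_reads[OF conj.hyps(1)] read_once_reads[OF conj.hyps(2)]
  have "dep f \<subseteq> dep (\<lambda>b. f b \<and> g b)"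
    using dep_subset_dep_conj[of A f B g c] r conj.hyps(3) read_once_center[OF conj.hyps(2)] by simp
  moreover have "dep g \<subseteq> dep (\<lambda>b. g b \<and> f b)"
    using dep_subset_dep_conj[of B g A f c] r conj.hyps(3) read_once_center[OF conj.hyps(1)]
    by (simp add: Int_commute)
  moreover have "dep (\<lambda>b. g b \<and> f b) = dep (\<lambda>b. f b \<and> g b)"
    unfolding dep_def by auto
  ultimately have "A \<union> B \<subseteq> dep (\<lambda>b. f b \<and> g b)" using conj.IH by simp
  moreover have "dep (\<lambda>b. f b \<and> g b) \<subseteq> A \<union> B"
    by (rule dep_subset[OF read_once_reads]) (rule read_once.conj[OF conj.hyps])
  ultimately show ?case by blast
next
  case (disj A f B g)
  let ?c = "\<lambda>i. \<not> c i" and ?f = "\<lambda>b. \<not> f b" and ?g = "\<lambda>b. \<not> g b"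
  have f: "read_once ?c A ?f" and g: "read_once ?c B ?g" using disj.hyps read_once_not by auto
  note r = read_once_reads[OF f] read_once_reads[OF g]
  have "dep ?f \<subseteq> dep (\<lambda>b. ?f b \<and> ?g b)"
    using dep_subset_dep_conj[of A ?f B ?g ?c] r disj.hyps(3) read_once_center[OF g] by simp
  moreover have "dep ?g \<subseteq> dep (\<lambda>b. ?g b \<and> ?f b)"
    using dep_subset_dep_conj[of B ?g A ?f ?c] r disj.hyps(3) read_once_center[OF f]
    by (simp add: Int_commute)
  moreover have "dep (\<lambda>b. ?f b \<and> ?g b) = dep (\<lambda>b. f b \<or> g b)"
    "dep (\<lambda>b. ?g b \<and> ?f b) = dep (\<lambda>b. f b \<or> g b)"
    unfolding dep_def by auto
  ultimately have "A \<union> B \<subseteq> dep (\<lambda>b. f b \<or> g b)" using disj.IH dep_not[of f] dep_not[of g] by simp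
  moreover have "dep (\<lambda>b. f b \<or> g b) \<subseteq> A \<union> B"
    by (rule dep_subset[OF read_once_reads]) (rule read_once.disj[OF disj.hyps])
  ultimately show ?case by blast
qed

section \<open>Free signs that leave a prescribed function of the fixed signs\<close>

definition slice :: "'i set \<Rightarrow> (('i \<Rightarrow> bool) \<Rightarrow> bool) \<Rightarrow> ('i \<Rightarrow> bool) \<Rightarrow> ('i \<Rightarrow> bool) \<Rightarrow> bool" where
  "slice I f t0 = (\<lambda>t. \<forall>\<beta>. f (override_on t \<beta> I) = f (override_on t0 \<beta> I))"

text \<open>In the application \<open>t0\<close> holds the signs of a displacement from a point of
  the closure of a region to a point of the region, and \<open>slice\<close> asks for the same
  function of the signs in \<open>I\<close>. The premise says that no sign in \<open>I\<close> has
  become irrelevant at \<open>t0\<close>. The first alternative is the case without free variables,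
  where no read-once function exists.\<close>

definition splits :: "'i set \<Rightarrow> (('i \<Rightarrow> bool) \<Rightarrow> bool) \<Rightarrow> bool" where
  "splits A f \<longleftrightarrow> (\<forall>I t0. I \<inter> A \<subseteq> dep (\<lambda>\<beta>. f (override_on t0 \<beta> I)) \<longrightarrow>
     (A \<subseteq> I \<and> slice I f t0 = (\<lambda>_. True)) \<or> (\<exists>c. read_once c (A - I) (slice I f t0)))"

text \<open>Both \<open>slice\<close> and \<open>dep\<close> only compare values of \<open>f\<close>
  with each other, so they are blind to negation. This yields disjunctions from
  conjunctions.\<close>

lemma splits_not: "splits A (\<lambda>b. \<not> f b) = splits A f"
  unfolding splits_def slice_def dep_not by simp

lemma slice_disjoint:
  assumes "reads A f" "A \<inter> I = {}"
  shows "slice I f t0 = (\<lambda>t. f t = f t0)"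
proof -
  have "f (override_on t \<beta> I) = f t" for t \<beta>
    by (rule readsD[OF assms(1)]) (use assms(2) in \<open>auto simp: override_on_def\<close>)
  then show ?thesis unfolding slice_def by simp
qed

text \<open>Without variables in \<open>I\<close> the condition only asks \<open>f\<close> to keep
  its value at \<open>t0\<close>, so it is \<open>f\<close> or its negation.\<close>

lemma splits_disjoint:
  assumes "read_once c A f" "A \<inter> I = {}"
  shows "\<exists>c. read_once c (A - I) (slice I f t0)"
proof -
  have "A - I = A" using assms(2) by blast
  moreover have "slice I f t0 = (if f t0 then f else (\<lambda>t. \<not> f t))"
    unfolding slice_disjoint[OF read_once_reads[OF assms(1)] assms(2)] by auto
  ultimately show ?thesis using assms(1) read_once_not[OF assms(1)] by (auto split: if_splits)
qed

text \<open>Here \<open>g\<close> contains no variable of \<open>I\<close>. Were it false at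
  \<open>t0\<close>, the conjunction would be false for all signs in \<open>I\<close>, and no sign
  in \<open>A \<inter> I\<close> could be essential. So \<open>g\<close> must take its neutral value
  True, and what remains is the condition on \<open>f\<close>.\<close>

lemma splits_conj_half:
  assumes f: "read_once c A f" and g: "read_once c B g" and AB: "A \<inter> B = {}"
    and sf: "splits A f" and I: "I \<inter> (A \<union> B) \<subseteq> dep (\<lambda>\<beta>. f (override_on t0 \<beta> I) \<and> g (override_on t0 \<beta> I))"
    and IB: "B \<inter> I = {}" and IA: "A \<inter> I \<noteq> {}"
  shows "\<exists>c. read_once c (A \<union> B - I) (slice I (\<lambda>b. f b \<and> g b) t0)"
proof -
  have gI: "g (override_on t \<beta> I) = g t" for t \<beta>
    by (rule readsD[OF read_once_reads[OF g]]) (use IB in \<open>auto simp: override_on_def\<close>)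
  obtain j where "j \<in> A \<inter> I" using IA by blast
  then have "j \<in> dep (\<lambda>\<beta>. f (override_on t0 \<beta> I) \<and> g (override_on t0 \<beta> I))" using I by blast
  then obtain \<beta>
    where \<beta>: "(f (override_on t0 (\<beta>(j:=True)) I) \<and> g t0) \<noteq> (f (override_on t0 (\<beta>(j:=False)) I) \<and> g t0)"
    unfolding dep_def gI by blast
  then have t0: "g t0" by auto
  obtain \<beta>1 where \<beta>1: "f (override_on t0 \<beta>1 I)" using \<beta> by auto
  have "I \<inter> A \<subseteq> dep (\<lambda>\<beta>. f (override_on t0 \<beta> I))" using I unfolding gI using t0 by auto
  with sf have *: "(A \<subseteq> I \<and> slice I f t0 = (\<lambda>_. True)) \<or> (\<exists>c. read_once c (A - I) (slice I f t0))"
    unfolding splits_def by blast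
  \<comment> \<open>At \<open>\<beta>1\<close> the conjunction holds for \<open>t0\<close>, hence
    for every \<open>t\<close> in the slice, which forces \<open>g t\<close>.\<close>
  have s: "slice I (\<lambda>b. f b \<and> g b) t0 = (\<lambda>t. slice I f t0 t \<and> g t)"
    unfolding slice_def gI using t0 \<beta>1 by (intro ext) blast
  from * show ?thesis
  proof
    assume "A \<subseteq> I \<and> slice I f t0 = (\<lambda>_. True)"
    moreover from this have "A \<union> B - I = B" using IB by blast
    ultimately show ?thesis using s g by auto
  next
    assume "\<exists>c. read_once c (A - I) (slice I f t0)"
    then obtain c' where "read_once c' (A - I) (slice I f t0)" by blast
    from read_once_conj[OF this g] have "\<exists>c. read_once c (A - I \<union> B) (\<lambda>t. slice I f t0 t \<and> g t)"
      using AB by blast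
    moreover have "A \<union> B - I = A - I \<union> B" using IB by blast
    ultimately show ?thesis using s by simp
  qed
qed

lemma splits_conj:
  assumes f: "read_once c A f" and g: "read_once c B g" and AB: "A \<inter> B = {}"
    and sf: "splits A f" and sg: "splits B g"
  shows "splits (A \<union> B) (\<lambda>b. f b \<and> g b)"
  unfolding splits_def
proof (intro allI impI)
  fix I t0
  let ?fg = "\<lambda>b. f b \<and> g b"
  assume I: "I \<inter> (A \<union> B) \<subseteq> dep (\<lambda>\<beta>. f (override_on t0 \<beta> I) \<and> g (override_on t0 \<beta> I))"
  consider "A \<inter> I = {}" "B \<inter> I = {}" | "A \<inter> I \<noteq> {}" "B \<inter> I = {}" | "A \<inter> I = {}" "B \<inter> I \<noteq> {}"
    | "A \<inter> I \<noteq> {}" "B \<inter> I \<noteq> {}" by blast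
  then show "(A \<union> B \<subseteq> I \<and> slice I ?fg t0 = (\<lambda>_. True)) \<or> (\<exists>c. read_once c (A \<union> B - I) (slice I ?fg t0))"
  proof cases
    case 1
    then have "(A \<union> B) \<inter> I = {}" by blast
    with splits_disjoint[OF read_once.conj[OF f g AB]] show ?thesis by blast
  next
    case 2
    from splits_conj_half[OF f g AB sf I 2(2,1)] show ?thesis by blast
  next
    case 3
    have "(\<lambda>\<beta>. g (override_on t0 \<beta> I) \<and> f (override_on t0 \<beta> I)) = (\<lambda>\<beta>. f (override_on t0 \<beta> I) \<and> g (override_on t0 \<beta> I))"
      by auto
    then have "\<exists>c. read_once c (B \<union> A - I) (slice I (\<lambda>b. g b \<and> f b) t0)"
      using AB I 3 by (intro splits_conj_half[OF g f _ sg]) (auto simp: Un_commute)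
    then show ?thesis by (simp add: Un_commute conj_commute)
  next
    \<comment> \<open>Both factors contain signs of \<open>I\<close>. The condition separates
      because the signs read by \<open>f\<close> and by \<open>g\<close> can be varied
      independently.\<close>
    case 4
    have r: "(I \<inter> A) \<subseteq> dep (\<lambda>\<beta>. f (override_on t0 \<beta> I))"
    proof
      fix i assume i: "i \<in> I \<inter> A"
      then have "i \<in> dep (\<lambda>\<beta>. f (override_on t0 \<beta> I) \<and> g (override_on t0 \<beta> I))" using I by blast
      then obtain \<beta>
        where \<beta>: "(f (override_on t0 (\<beta>(i:=True)) I) \<and> g (override_on t0 (\<beta>(i:=True)) I))
        \<noteq> (f (override_on t0 (\<beta>(i:=False)) I) \<and> g (override_on t0 (\<beta>(i:=False)) I))" unfolding dep_def by blast
      have "g (override_on t0 (\<beta>(i:=True)) I) = g (override_on t0 (\<beta>(i:=False)) I)"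
        by (rule readsD[OF read_once_reads[OF g]]) (use AB i in \<open>auto simp: override_on_def\<close>)
      with \<beta> show "i \<in> dep (\<lambda>\<beta>. f (override_on t0 \<beta> I))" unfolding dep_def by auto
    qed
    have r': "(I \<inter> B) \<subseteq> dep (\<lambda>\<beta>. g (override_on t0 \<beta> I))"
    proof
      fix i assume i: "i \<in> I \<inter> B"
      then have "i \<in> dep (\<lambda>\<beta>. f (override_on t0 \<beta> I) \<and> g (override_on t0 \<beta> I))" using I by blast
      then obtain \<beta>
        where \<beta>: "(f (override_on t0 (\<beta>(i:=True)) I) \<and> g (override_on t0 (\<beta>(i:=True)) I))
        \<noteq> (f (override_on t0 (\<beta>(i:=False)) I) \<and> g (override_on t0 (\<beta>(i:=False)) I))" unfolding dep_def by blast
      have "f (override_on t0 (\<beta>(i:=True)) I) = f (override_on t0 (\<beta>(i:=False)) I)"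
        by (rule readsD[OF read_once_reads[OF f]]) (use AB i in \<open>auto simp: override_on_def\<close>)
      with \<beta> show "i \<in> dep (\<lambda>\<beta>. g (override_on t0 \<beta> I))" unfolding dep_def by auto
    qed
    \<comment> \<open>An essential sign exists, so the conjunction is true for some signs in
      \<open>I\<close>. These signs \<open>\<beta>0\<close> keep one factor true while the other is
      tested.\<close>
    obtain j where "j \<in> A \<inter> I" using 4 by blast
    then have "j \<in> dep (\<lambda>\<beta>. f (override_on t0 \<beta> I) \<and> g (override_on t0 \<beta> I))" using I by blast
    then obtain \<beta>0 where b0: "f (override_on t0 \<beta>0 I)" "g (override_on t0 \<beta>0 I)"
      unfolding dep_def by blast
    have ff: "f (override_on t (override_on \<beta>0 \<beta> A) I) = f (override_on t \<beta> I)" for t \<beta>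
      by (rule readsD[OF read_once_reads[OF f]]) (auto simp: override_on_def)
    have gf: "g (override_on t (override_on \<beta>0 \<beta> A) I) = g (override_on t \<beta>0 I)" for t \<beta>
      by (rule readsD[OF read_once_reads[OF g]]) (use AB in \<open>auto simp: override_on_def\<close>)
    have gg: "g (override_on t (override_on \<beta>0 \<beta> B) I) = g (override_on t \<beta> I)" for t \<beta>
      by (rule readsD[OF read_once_reads[OF g]]) (auto simp: override_on_def)
    have fg: "f (override_on t (override_on \<beta>0 \<beta> B) I) = f (override_on t \<beta>0 I)" for t \<beta>
      by (rule readsD[OF read_once_reads[OF f]]) (use AB in \<open>auto simp: override_on_def\<close>)
    have s: "slice I ?fg t0 = (\<lambda>t. slice I f t0 t \<and> slice I g t0 t)"
    proof (intro ext iffI)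
      fix t assume t: "slice I ?fg t0 t"
      then have t': "f (override_on t \<beta>0 I)" "g (override_on t \<beta>0 I)"
        using b0 unfolding slice_def by auto
      have "f (override_on t \<beta> I) = f (override_on t0 \<beta> I)" for \<beta>
        using t[unfolded slice_def, rule_format, of "override_on \<beta>0 \<beta> A"] t' b0 by (simp add: ff gf)
      moreover have "g (override_on t \<beta> I) = g (override_on t0 \<beta> I)" for \<beta>
        using t[unfolded slice_def, rule_format, of "override_on \<beta>0 \<beta> B"] t' b0 by (simp add: gg fg)
      ultimately show "slice I f t0 t \<and> slice I g t0 t" unfolding slice_def by blast
    qed (auto simp: slice_def)
    have f': "(A \<subseteq> I \<and> slice I f t0 = (\<lambda>_. True)) \<or> (\<exists>c. read_once c (A - I) (slice I f t0))"
      using sf r unfolding splits_def by blast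
    have g': "(B \<subseteq> I \<and> slice I g t0 = (\<lambda>_. True)) \<or> (\<exists>c. read_once c (B - I) (slice I g t0))"
      using sg r' unfolding splits_def by blast
    have d: "A \<union> B - I = (A - I) \<union> (B - I)" by blast
    show ?thesis
    proof (cases "A \<subseteq> I \<and> slice I f t0 = (\<lambda>_. True)")
      case True
      then have "A \<union> B - I = B - I" "slice I ?fg t0 = slice I g t0" using s by auto
      then show ?thesis using g' True by auto
    next
      case F: False
      show ?thesis
      proof (cases "B \<subseteq> I \<and> slice I g t0 = (\<lambda>_. True)")
        case True
        then have "A \<union> B - I = A - I" "slice I ?fg t0 = slice I f t0" using s by auto
        then show ?thesis using f' True by auto
      next
        case False
        with F f' g' obtain c1 c2
          where "read_once c1 (A - I) (slice I f t0)" "read_once c2 (B - I) (slice I g t0)"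
          by blast
        from read_once_conj[OF this] AB show ?thesis unfolding d s by blast
      qed
    qed
  qed
qed

lemma read_once_splits: "read_once c A f \<Longrightarrow> splits A f"
proof (induction rule: read_once.induct)
  case (lit i)
  show ?case unfolding splits_def
  proof (intro allI impI)
    fix I t0
    let ?f = "\<lambda>b. b i = c i"
    show "({i} \<subseteq> I \<and> slice I ?f t0 = (\<lambda>_. True)) \<or> (\<exists>c. read_once c ({i} - I) (slice I ?f t0))"
    proof (cases "i \<in> I")
      case True
      then show ?thesis by (simp add: slice_def override_on_def)
    next
      case False
      then show ?thesis using splits_disjoint[OF read_once.lit[of c i], of I t0] by simp
    qed
  qed
next
  case (conj A f B g)
  then show ?case by (blast intro: splits_conj)
next
  case (disj A f B g)
  have "splits (A \<union> B) (\<lambda>b. \<not> f b \<and> \<not> g b)"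
    using disj by (intro splits_conj[OF read_once_not read_once_not]) (auto simp: splits_not)
  then show ?case by (subst splits_not[symmetric]) simp
qed

subsection \<open>Germs and tangent cones\<close>

definition pdiff :: "(nat \<Rightarrow> real) \<Rightarrow> (nat \<Rightarrow> real) \<Rightarrow> nat \<Rightarrow> real" where
  "pdiff x v = (\<lambda>i. x i - v i)"

text \<open>A point belongs to a union of orthants when at least one orthant through it is selected;
  this is the existential quantifier over \<open>b\<close>.\<close>

definition sign_cone :: "nat \<Rightarrow> ((nat \<Rightarrow> bool) \<Rightarrow> bool) \<Rightarrow> (nat \<Rightarrow> real) set" where
  "sign_cone d f = {x \<in> Rn d. \<exists>b. restr x f b}"

text \<open>The point \<open>v\<close> may lie outside \<open>P\<close>; then \<open>f\<close> is
  constantly False (\<open>germ_mem\<close>). The cube is closed, as in the definition of tangent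
  cones.\<close>

definition germ ::
  "nat \<Rightarrow> (nat \<Rightarrow> real) set \<Rightarrow> (nat \<Rightarrow> real) \<Rightarrow> ((nat \<Rightarrow> bool) \<Rightarrow> bool) \<Rightarrow> real \<Rightarrow> bool" where
  "germ d P v f \<delta> \<longleftrightarrow> reads {..<d} f \<and> 0 < \<delta> \<and> v \<in> Rn d \<and>
     (\<forall>x\<in>Rn d. (\<forall>i<d. \<bar>x i - v i\<bar> \<le> \<delta>) \<longrightarrow> (x \<in> P \<longleftrightarrow> (\<exists>b. restr (pdiff x v) f b)))"

lemma germD:
  assumes "germ d P v f \<delta>"
  shows "reads {..<d} f" "0 < \<delta>" "v \<in> Rn d"
    "\<And>x. x \<in> Rn d \<Longrightarrow> (\<And>i. i < d \<Longrightarrow> \<bar>x i - v i\<bar> \<le> \<delta>) \<Longrightarrow> x \<in> P \<longleftrightarrow> (\<exists>b. restr (pdiff x v) f b)"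
  using assms unfolding germ_def by auto

lemma pdiff_Rn: "x \<in> Rn d \<Longrightarrow> v \<in> Rn d \<Longrightarrow> pdiff x v \<in> Rn d"
  unfolding Rn_def pdiff_def by auto

lemma finite_pos_lower_bound:
  fixes m :: "'i \<Rightarrow> real"
  assumes "finite A" "\<And>i. i \<in> A \<Longrightarrow> 0 < m i"
  obtains e where "0 < e" "\<And>i. i \<in> A \<Longrightarrow> e \<le> m i"
proof
  show "0 < Min (insert 1 (m ` A))" using assms by simp
  show "Min (insert 1 (m ` A)) \<le> m i" if "i \<in> A" for i using assms(1) that by simp
qed

text \<open>An interior point of an orthant when \<open>e\<close> is positive: no coordinate below
  \<open>d\<close> is zero, so membership in a cone reads off \<open>f b\<close> itself.\<close>

definition sign_point :: "nat \<Rightarrow> real \<Rightarrow> (nat \<Rightarrow> bool) \<Rightarrow> nat \<Rightarrow> real" where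
  "sign_point d e b = (\<lambda>i. if i < d then if b i then e else - e else 0)"

lemma restr_sign_point:
  assumes "reads {..<d} f" "0 < e"
  shows "restr (sign_point d e b) f b' = f b"
  unfolding restr_def
  by (rule readsD[OF assms(1)]) (use assms(2) in \<open>simp add: signfix_def sign_point_def\<close>)

lemma sign_cone_inj:
  assumes "reads {..<d} f" "reads {..<d} g" "sign_cone d f = sign_cone d g"
  shows "f = g"
proof
  fix b
  have "f b \<longleftrightarrow> sign_point d 1 b \<in> sign_cone d f" "g b \<longleftrightarrow> sign_point d 1 b \<in> sign_cone d g"
    using assms(1,2)
    by (auto simp: sign_cone_def restr_sign_point) (auto simp: sign_point_def Rn_def)
  then show "f b = g b" using assms(3) by simp
qed

lemma germ_unique:
  assumes f: "germ d P v f \<delta>" and g: "germ d P v g \<epsilon>"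
  shows "f = g"
proof
  fix b
  define e where "e = min \<delta> \<epsilon>"
  have e: "0 < e" "e \<le> \<delta>" "e \<le> \<epsilon>" using germD(2)[OF f] germD(2)[OF g] unfolding e_def by auto
  define x where "x = (\<lambda>i. v i + sign_point d e b i)"
  have xR: "x \<in> Rn d" using germD(3)[OF f] by (auto simp: x_def Rn_def sign_point_def)
  have d: "pdiff x v = sign_point d e b" by (auto simp: x_def pdiff_def)
  have "\<bar>x i - v i\<bar> \<le> e" for i using e by (auto simp: x_def sign_point_def)
  then have "x \<in> P \<longleftrightarrow> f b" "x \<in> P \<longleftrightarrow> g b"
    using germD(4)[OF f xR] germD(4)[OF g xR] e d germD(1)[OF f] germD(1)[OF g]
    by (auto simp: restr_sign_point intro: order_trans)
  then show "f b = g b" by simp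
qed

lemma germ_mem: "germ d P v f \<delta> \<Longrightarrow> v \<in> P \<longleftrightarrow> (\<exists>b. f b)"
  using germD(2)[of d P v f \<delta>] germD(4)[of d P v f \<delta> v] germD(3)[of d P v f \<delta>]
  by (simp add: restr_def signfix_def pdiff_def)

text \<open>Near \<open>x\<close> the nonzero coordinates of the displacement from \<open>v\<close>
  keep their signs, and the zero ones take the signs of the displacement from \<open>x\<close>.
  Hence the cone at \<open>x\<close> arises by substitution.\<close>

lemma germ_shift:
  assumes g: "germ d P v f \<delta>" and x: "x \<in> Rn d" "\<And>i. i < d \<Longrightarrow> \<bar>x i - v i\<bar> < \<delta>"
  obtains \<epsilon> where "germ d P x (restr (pdiff x v) f) \<epsilon>"
proof -
  let ?y = "pdiff x v"
  \<comment> \<open>The first bound keeps the cube around \<open>x\<close> inside the one around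
    \<open>v\<close>. The second, half of a nonzero coordinate, preserves its sign on the closed
    cube; 1 is a placeholder for zero coordinates.\<close>
  obtain e where e: "0 < e"
    "\<And>i. i \<in> {..<d} \<Longrightarrow> e \<le> min (\<delta> - \<bar>?y i\<bar>) (if ?y i = 0 then 1 else \<bar>?y i\<bar> / 2)"
    by (rule finite_pos_lower_bound[of "{..<d}" "\<lambda>i. min (\<delta> - \<bar>?y i\<bar>) (if ?y i = 0 then 1 else \<bar>?y i\<bar> / 2)"])
      (use x(2) in \<open>auto simp: pdiff_def\<close>)
  have "germ d P x (restr ?y f) e"
    unfolding germ_def
  proof (intro conjI ballI impI)
    fix z assume z: "z \<in> Rn d" "\<forall>i<d. \<bar>z i - x i\<bar> \<le> e"
    have "\<bar>z i - v i\<bar> \<le> \<delta>" if "i < d" for i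
      using z(2) e(2)[of i] that by (force simp: pdiff_def)
    then have "z \<in> P \<longleftrightarrow> (\<exists>b. restr (pdiff z v) f b)" by (rule germD(4)[OF g z(1)])
    moreover have "restr (pdiff z v) f b = restr (pdiff z x) (restr ?y f) b" for b
      unfolding restr_def
    proof (rule readsD[OF germD(1)[OF g]])
      fix i assume i: "i \<in> {..<d}"
      have "\<bar>z i - x i\<bar> \<le> e" "e \<le> (if ?y i = 0 then 1 else \<bar>?y i\<bar> / 2)"
        using z(2) e(2)[OF i] i by auto
      then show "signfix (pdiff z v) b i = signfix ?y (signfix (pdiff z x) b) i"
        by (auto simp: signfix_def pdiff_def split: if_splits)
    qed
    ultimately show "z \<in> P \<longleftrightarrow> (\<exists>b. restr (pdiff z x) (restr ?y f) b)" by simp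
  qed (use germD(1)[OF g] reads_restr e(1) x(1) in auto)
  then show thesis by (rule that)
qed

text \<open>Sets of sign vectors correspond to Boolean functions, with the sign 1 read as
  True.\<close>

lemma local_arrangement_iff: "local_arrangement d A \<longleftrightarrow> (\<exists>f. reads {..<d} f \<and> A = sign_cone d f)"
proof
  assume "local_arrangement d A"
  then obtain S
    where S: "\<forall>s\<in>S. signs d s" "A = \<Union>(orthant d ` S)" unfolding local_arrangement_def by blast
  define f where "f = (\<lambda>b. \<exists>s\<in>S. \<forall>i<d. b i = (s i = 1))"
  have "A = sign_cone d f"
  proof (intro set_eqI iffI)
    fix x assume "x \<in> A"
    then obtain s where s: "s \<in> S" "x \<in> Rn d" "\<forall>i<d. s i * x i \<ge> 0" unfolding S orthant_def by blast
    have "signfix x (\<lambda>i. s i = 1) i = (s i = 1)" if "i < d" for i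
    proof -
      have "s i = 1 \<or> s i = -1" using S(1) s(1) that unfolding signs_def by blast
      then show ?thesis using s(3) that by (auto simp: signfix_def)
    qed
    then have "restr x f (\<lambda>i. s i = 1)" unfolding restr_def f_def using s(1) by blast
    then show "x \<in> sign_cone d f" unfolding sign_cone_def using s(2) by blast
  next
    fix x assume "x \<in> sign_cone d f"
    then obtain b s where b: "x \<in> Rn d" "s \<in> S" "\<forall>i<d. signfix x b i = (s i = 1)"
      unfolding sign_cone_def restr_def f_def by blast
    have "s i * x i \<ge> 0" if "i < d" for i
    proof -
      have "s i = 1 \<or> s i = -1" using S(1) b(2) that unfolding signs_def by blast
      then show ?thesis using b(3) that by (auto simp: signfix_def)
    qed
    then show "x \<in> A" unfolding S(2) orthant_def using b by blast
  qed
  moreover have "reads {..<d} f" unfolding reads_def f_def by simp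
  ultimately show "\<exists>f. reads {..<d} f \<and> A = sign_cone d f" by blast
next
  assume "\<exists>f. reads {..<d} f \<and> A = sign_cone d f"
  then obtain f where f: "reads {..<d} f" "A = sign_cone d f" by blast
  define S where "S = {s. signs d s \<and> f (\<lambda>i. s i = 1)}"
  have "A = \<Union>(orthant d ` S)"
  proof (intro set_eqI iffI)
    fix x assume "x \<in> A"
    then obtain b
      where b: "x \<in> Rn d" "f (signfix x b)" unfolding f(2) sign_cone_def restr_def by blast
    define s :: "nat \<Rightarrow> real" where "s = (\<lambda>i. if signfix x b i then 1 else -1)"
    have "(\<lambda>i. s i = 1) = signfix x b" by (auto simp: s_def)
    then have "s \<in> S" unfolding S_def using b(2) by (simp add: signs_def s_def)
    moreover have "x \<in> orthant d s" using b(1) by (auto simp: orthant_def s_def signfix_def)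
    ultimately show "x \<in> \<Union>(orthant d ` S)" by blast
  next
    fix x assume "x \<in> \<Union>(orthant d ` S)"
    then obtain s where s: "signs d s" "f (\<lambda>i. s i = 1)" "x \<in> Rn d" "\<forall>i<d. s i * x i \<ge> 0"
      unfolding S_def orthant_def by blast
    have "f (signfix x (\<lambda>i. s i = 1)) = f (\<lambda>i. s i = 1)"
    proof (rule readsD[OF f(1)])
      fix i assume i: "i \<in> {..<d}"
      then have "s i = 1 \<or> s i = -1" using s(1) unfolding signs_def by blast
      then show "signfix x (\<lambda>i. s i = 1) i = (s i = 1)" using s(4) i by (auto simp: signfix_def)
    qed
    then show "x \<in> A" unfolding f(2) sign_cone_def restr_def using s by blast
  qed
  then show "local_arrangement d A"
    unfolding local_arrangement_def by (intro exI[of _ S]) (simp add: S_def)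
qed

lemma translate_cube:
  assumes "v \<in> Rn d"
  shows "translate v (A \<inter> cube d \<delta>) = {x \<in> Rn d. pdiff x v \<in> A \<and> (\<forall>i<d. \<bar>x i - v i\<bar> \<le> \<delta>)}"
proof (intro set_eqI iffI)
  fix x assume "x \<in> translate v (A \<inter> cube d \<delta>)"
  then obtain y
    where y: "y \<in> A" "y \<in> cube d \<delta>" "x = (\<lambda>i. v i + y i)" unfolding translate_def by blast
  then have "pdiff x v = y" by (auto simp: pdiff_def)
  then show "x \<in> {x \<in> Rn d. pdiff x v \<in> A \<and> (\<forall>i<d. \<bar>x i - v i\<bar> \<le> \<delta>)}"
    using y assms by (auto simp: cube_def aabox_def Rn_def abs_le_iff)
next
  fix x assume x: "x \<in> {x \<in> Rn d. pdiff x v \<in> A \<and> (\<forall>i<d. \<bar>x i - v i\<bar> \<le> \<delta>)}"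
  then have "pdiff x v \<in> cube d \<delta>"
    using assms by (auto simp: cube_def aabox_def pdiff_def Rn_def abs_le_iff)
  moreover have "x = (\<lambda>i. v i + pdiff x v i)" by (auto simp: pdiff_def)
  ultimately show "x \<in> translate v (A \<inter> cube d \<delta>)" unfolding translate_def using x by blast
qed

lemma tangent_cone_eq:
  assumes g: "germ d P v f \<delta>"
  shows "tangent_cone d P v = sign_cone d f"
proof -
  note v = germD(3)[OF g]
  \<comment> \<open>\<open>germ\<close> is the defining property of the tangent cone in terms of
    functions, so \<open>germ_unique\<close> justifies the definite description.\<close>
  have tr: "(P \<inter> translate v (cube d e) = translate v (sign_cone d h \<inter> cube d e)) \<longleftrightarrow> germ d P v h e"
    if "reads {..<d} h" "0 < e" for h e
    using translate_cube[OF v, of UNIV e] translate_cube[OF v, of "sign_cone d h" e] that v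
    unfolding germ_def by (auto simp: sign_cone_def pdiff_Rn)
  show ?thesis
    unfolding tangent_cone_def
  proof (rule the_equality)
    show "local_arrangement d (sign_cone d f) \<and>
        (\<exists>\<delta>>0. P \<inter> translate v (cube d \<delta>) = translate v (sign_cone d f \<inter> cube d \<delta>))"
      using g germD(1,2)[OF g] tr local_arrangement_iff by blast
    fix A assume A: "local_arrangement d A \<and>
        (\<exists>\<delta>>0. P \<inter> translate v (cube d \<delta>) = translate v (A \<inter> cube d \<delta>))"
    then obtain h where h: "reads {..<d} h" "A = sign_cone d h" using local_arrangement_iff by blast
    with A tr obtain e where "germ d P v h e" by blast
    with germ_unique[OF g] h(2) show "A = sign_cone d f" by simp
  qed
qed

lemma congruent_cones_refl: "congruent_cones d A A"
  unfolding congruent_cones_def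
  by (rule exI[of _ id], rule exI[of _ "\<lambda>_. 1"]) (auto simp: permutes_id signs_def)

text \<open>A signed permutation renames the variables and negates some of them, so it carries
  essential variables to essential variables. Through this invariant congruence controls the
  regions.\<close>

lemma congruent_cones_card_dep:
  assumes f: "reads {..<d} f" and g: "reads {..<d} g" and c: "congruent_cones d (sign_cone d f) (sign_cone d g)"
  shows "card (dep f) = card (dep g)"
proof -
  from c obtain \<sigma> s where \<sigma>: "\<sigma> permutes {..<d}" and s: "signs d s"
    and im: "sign_cone d g = (\<lambda>x i. s i * x (\<sigma> i)) ` sign_cone d f"
      unfolding congruent_cones_def by blast
  have s1: "s i = 1 \<or> s i = - 1" if "i < d" for i using s that unfolding signs_def by blast
  have \<sigma>d: "\<sigma> i < d" if "i < d" for i using permutes_in_image[OF \<sigma>, of i] that by simp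
  have \<sigma>i: "inj \<sigma>" using \<sigma> permutes_inj by blast
  \<comment> \<open>\<open>m b\<close> is the sign vector of the image of
    \<open>sign_point d 1 b\<close> under the signed permutation.\<close>
  define m where "m = (\<lambda>b i. b (\<sigma> i) = (s i = 1))"
  have fg: "f b = g (m b)" for b
  proof -
    have e: "(\<lambda>i. s i * sign_point d 1 b (\<sigma> i)) = sign_point d 1 (m b)"
    proof
      fix i show "s i * sign_point d 1 b (\<sigma> i) = sign_point d 1 (m b) i"
        using s1[of i] \<sigma>d[of i] permutes_not_in[OF \<sigma>, of i]
        by (cases "i < d") (auto simp: sign_point_def m_def)
    qed
    have sR: "sign_point d 1 b' \<in> Rn d" for b' by (auto simp: sign_point_def Rn_def)
    have "f b \<longleftrightarrow> sign_point d 1 b \<in> sign_cone d f"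
      using f sR by (auto simp: sign_cone_def restr_sign_point)
    also have "\<dots> \<longleftrightarrow> sign_point d 1 (m b) \<in> sign_cone d g"
    proof
      assume "sign_point d 1 b \<in> sign_cone d f"
      then show "sign_point d 1 (m b) \<in> sign_cone d g" unfolding im e[symmetric] by blast
    next
      assume "sign_point d 1 (m b) \<in> sign_cone d g"
      then obtain x where x: "x \<in> sign_cone d f" "sign_point d 1 (m b) = (\<lambda>i. s i * x (\<sigma> i))"
        unfolding im by blast
      have "x j = sign_point d 1 b j" for j
      proof (cases "j < d")
        case True
        obtain i where i: "j = \<sigma> i" using permutes_surj[OF \<sigma>] by blast
        then have "i < d" using True permutes_in_image[OF \<sigma>, of i] by simp
        moreover have "s i * x (\<sigma> i) = s i * sign_point d 1 b (\<sigma> i)"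
          using fun_cong[OF x(2), of i] fun_cong[OF e, of i] by metis
        ultimately show ?thesis using s1[of i] i by auto
      next
        case False
        then show ?thesis using x(1) by (auto simp: sign_cone_def Rn_def sign_point_def)
      qed
      then have "x = sign_point d 1 b" by (rule ext)
      then show "sign_point d 1 b \<in> sign_cone d f" using x(1) by simp
    qed
    also have "\<dots> \<longleftrightarrow> g (m b)" using g sR by (auto simp: sign_cone_def restr_sign_point)
    finally show ?thesis .
  qed
  have "dep f \<subseteq> \<sigma> ` dep g"
  proof
    fix j assume j: "j \<in> dep f"
    obtain i where i: "j = \<sigma> i" using permutes_surj[OF \<sigma>] by blast
    from j obtain b where b: "f (b(j := True)) \<noteq> f (b(j := False))" unfolding dep_def by blast
    have m: "m (b(j := x)) = (m b)(i := (x = (s i = 1)))" for x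
      using \<sigma>i by (auto simp: m_def i fun_eq_iff dest: injD)
    have "i \<in> dep g" using b not_depD[of i g "m b"] unfolding fg m by metis
    then show "j \<in> \<sigma> ` dep g" using i by blast
  qed
  moreover have "\<sigma> ` dep g \<subseteq> dep f"
  proof
    fix j assume "j \<in> \<sigma> ` dep g"
    then obtain i where i: "j = \<sigma> i" "i \<in> dep g" by blast
    then have id: "i < d" using dep_subset[OF g] by auto
    from i obtain b where b: "g (b(i := True)) \<noteq> g (b(i := False))" unfolding dep_def by blast
    \<comment> \<open>A preimage of \<open>b\<close> under \<open>m\<close>.\<close>
    define b' where "b' = (\<lambda>k. b (inv \<sigma> k) = (s (inv \<sigma> k) = 1))"
    have "m (b'(j := (x = (s i = 1)))) = b(i := x)" for x
      using \<sigma>i by (auto simp: m_def b'_def i fun_eq_iff dest: injD)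
    then have "f (b'(j := (x = (s i = 1)))) = g (b(i := x))" for x using fg by simp
    then show "j \<in> dep f" using b not_depD[of j f b'] by metis
  qed
  ultimately have "dep f = \<sigma> ` dep g" by blast
  then show ?thesis using card_image[OF inj_on_subset[OF \<sigma>i]] by simp
qed

subsection \<open>Compact locally conic sets\<close>

text \<open>The local half of the characterisation of orthogonal polytopes. It speaks only of points
  of \<open>P\<close>, so closedness has to come from compactness.\<close>

definition locally_conic :: "nat \<Rightarrow> (nat \<Rightarrow> real) set \<Rightarrow> bool" where
  "locally_conic d P \<longleftrightarrow> P \<subseteq> Rn d \<and> (\<forall>v\<in>P. \<exists>f \<delta>. germ d P v f \<delta>)"

text \<open>Membership in \<open>Rn d\<close> is not asked and only finitely many coordinates are
  bounded, which makes the set open in the product topology.\<close>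

definition open_box :: "nat \<Rightarrow> (nat \<Rightarrow> real) \<Rightarrow> real \<Rightarrow> (nat \<Rightarrow> real) set" where
  "open_box d v e = {x. \<forall>i<d. \<bar>x i - v i\<bar> < e}"

lemma open_open_box: "open (open_box d v e)"
proof -
  have "open {x::nat\<Rightarrow>real. \<bar>x i - v i\<bar> < e}" for i
    by (intro open_Collect_less continuous_on_rabs continuous_on_diff
        continuous_on_product_coordinates continuous_on_const)
  moreover have "open_box d v e = (\<Inter>i\<in>{..<d}. {x. \<bar>x i - v i\<bar> < e})"
    unfolding open_box_def by auto
  ultimately show ?thesis by (simp only:) (intro open_INT finite_lessThan ballI)
qed

lemma mem_open_box: "0 < e \<Longrightarrow> v \<in> open_box d v e"
  unfolding open_box_def by simp

text \<open>Tychonoff: the coordinates from \<open>d\<close> on range over the singleton of 0, so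
  the box is a product of compact sets over all indices.\<close>

lemma compact_aabox: "compact (aabox d a b)"
proof -
  have "aabox d a b = PiE UNIV (\<lambda>i. if i < d then {a i..b i} else {0})"
  proof (intro set_eqI iffI)
    fix x assume x: "x \<in> PiE UNIV (\<lambda>i. if i < d then {a i..b i} else {0})"
    have "x i \<in> (if i < d then {a i..b i} else {0})" for i using PiE_mem[OF x] by simp
    then have "\<And>i. i < d \<Longrightarrow> a i \<le> x i \<and> x i \<le> b i" "\<And>i. i \<ge> d \<Longrightarrow> x i = 0"
      by (metis atLeastAtMost_iff, metis linorder_not_less singletonD)
    then show "x \<in> aabox d a b" unfolding aabox_def Rn_def by blast
  qed (auto simp: aabox_def Rn_def)
  moreover have "compactin (product_topology (\<lambda>i. euclidean) UNIV)
      (PiE UNIV (\<lambda>i. if i < d then {a i..b i} else {0::real}))"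
    unfolding compactin_PiE by auto
  ultimately show ?thesis by (simp add: euclidean_product_topology)
qed

lemma germ_box:
  assumes "\<And>i. i < d \<Longrightarrow> a i < b i" "v \<in> Rn d"
  shows "\<exists>f \<delta>. germ d (aabox d a b) v f \<delta>"
proof -
  \<comment> \<open>A facet through \<open>v\<close> imposes the inward sign; for \<open>v\<close>
    outside the box \<open>f\<close> is constantly False. The bounds in \<open>m\<close> include
    half the distance to each facet value that \<open>v\<close> does not attain, so that none is
    crossed; 1 stands in where it is attained.\<close>
  define f where "f = (\<lambda>s. \<forall>i<d. a i \<le> v i \<and> v i \<le> b i \<and> (v i = a i \<longrightarrow> s i) \<and> (v i = b i \<longrightarrow> \<not> s i))"
  define m where "m = (\<lambda>i. min (if v i = a i then 1 else \<bar>v i - a i\<bar>/2)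
    (min (if v i = b i then 1 else \<bar>v i - b i\<bar>/2) ((b i - a i)/2)))"
  obtain e where e: "0 < e" "\<And>i. i \<in> {..<d} \<Longrightarrow> e \<le> m i"
    by (rule finite_pos_lower_bound[of "{..<d}" m]) (use assms in \<open>auto simp: m_def\<close>)
  have "germ d (aabox d a b) v f e"
    unfolding germ_def
  proof (intro conjI ballI impI)
    show "reads {..<d} f" unfolding reads_def f_def by simp
    fix x assume x: "x \<in> Rn d" "\<forall>i<d. \<bar>x i - v i\<bar> \<le> e"
    have i: "(a i \<le> x i \<and> x i \<le> b i) \<longleftrightarrow> a i \<le> v i \<and> v i \<le> b i \<and>
      (v i = a i \<longrightarrow> x i \<ge> v i) \<and> (v i = b i \<longrightarrow> x i \<le> v i)" if "i < d" for i
    proof -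
      have "\<bar>x i - v i\<bar> \<le> e" "e \<le> m i" using x(2) e(2) that by auto
      then have "\<bar>x i - v i\<bar> \<le> (if v i = a i then 1 else \<bar>v i - a i\<bar>/2)"
        "\<bar>x i - v i\<bar> \<le> (if v i = b i then 1 else \<bar>v i - b i\<bar>/2)" "\<bar>x i - v i\<bar> \<le> (b i - a i)/2"
        unfolding m_def by linarith+
      then show ?thesis using assms(1)[OF that] by (smt (verit, best) field_sum_of_halves)
    qed
    show "x \<in> aabox d a b \<longleftrightarrow> (\<exists>s. restr (pdiff x v) f s)"
    proof
      assume "x \<in> aabox d a b"
      then have "\<forall>i<d. a i \<le> x i \<and> x i \<le> b i" unfolding aabox_def by blast
      then have vi: "a i \<le> v i \<and> v i \<le> b i \<and> (v i = a i \<longrightarrow> x i \<ge> v i) \<and> (v i = b i \<longrightarrow> x i \<le> v i)"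
        if "i < d" for i using i[OF that] that by blast
      \<comment> \<open>Where \<open>x\<close> and \<open>v\<close> agree the sign is free. True at
        a lower facet and False at an upper one both point inwards.\<close>
      have "f (signfix (pdiff x v) (\<lambda>i. v i = a i))"
        unfolding f_def
      proof (intro allI impI)
        fix i assume "i < d"
        from vi[OF this] assms(1)[OF this]
        show "a i \<le> v i \<and> v i \<le> b i \<and> (v i = a i \<longrightarrow> signfix (pdiff x v) (\<lambda>i. v i = a i) i) \<and>
          (v i = b i \<longrightarrow> \<not> signfix (pdiff x v) (\<lambda>i. v i = a i) i)"
          by (auto simp: signfix_def pdiff_def)
      qed
      then have "restr (pdiff x v) f (\<lambda>i. v i = a i)" unfolding restr_def .
      then show "\<exists>s. restr (pdiff x v) f s" by blast
    next
      assume "\<exists>s. restr (pdiff x v) f s"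
      then obtain s where "f (signfix (pdiff x v) s)" unfolding restr_def by blast
      then have fi: "a i \<le> v i \<and> v i \<le> b i \<and> (v i = a i \<longrightarrow> signfix (pdiff x v) s i) \<and>
          (v i = b i \<longrightarrow> \<not> signfix (pdiff x v) s i)" if "i < d" for i
        using that unfolding f_def by blast
      have "\<forall>i<d. a i \<le> x i \<and> x i \<le> b i"
      proof (intro allI impI)
        fix j assume j: "j < d"
        from fi[OF j] show "a j \<le> x j \<and> x j \<le> b j"
          unfolding i[OF j] by (auto simp: signfix_def pdiff_def)
      qed
      then show "x \<in> aabox d a b" unfolding aabox_def using x(1) by blast
    qed
  qed (use e assms in auto)
  then show ?thesis by blast
qed

lemma germ_Un:
  assumes "germ d A v f \<delta>" "germ d B v g \<epsilon>"
  shows "germ d (A \<union> B) v (\<lambda>b. f b \<or> g b) (min \<delta> \<epsilon>)"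
  using assms unfolding germ_def reads_def by (auto simp: restr_def)

lemma pure_orthogonal_polytope_germ:
  assumes "pure_orthogonal_polytope d P" "v \<in> Rn d"
  shows "\<exists>f \<delta>. germ d P v f \<delta>"
proof -
  obtain \<B> where B: "finite \<B>" "\<forall>B\<in>\<B>. pure_box d B" "P = \<Union>\<B>"
    using assms(1) unfolding pure_orthogonal_polytope_def by blast
  from B(1,2) have "\<exists>f \<delta>. germ d (\<Union>\<B>) v f \<delta>"
  proof (induction \<B>)
    case empty
    have "germ d {} v (\<lambda>_. False) 1" unfolding germ_def reads_def restr_def using assms(2) by simp
    then show ?case by auto
  next
    case (insert B \<B>)
    obtain a b
      where "\<forall>i<d. a i < b i" "B = aabox d a b" using insert.prems unfolding pure_box_def by blast
    then obtain g \<epsilon> where "germ d B v g \<epsilon>" using germ_box[of d a b v] assms(2) by blast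
    moreover obtain f \<delta> where "germ d (\<Union>\<B>) v f \<delta>" using insert by blast
    ultimately show ?case using germ_Un[of d B v g \<epsilon> "\<Union>\<B>" f \<delta>] by auto
  qed
  then show ?thesis using B(3) by simp
qed

text \<open>Cut down to the cube of a germ, the selected orthants become full-dimensional boxes, and
  compactness leaves finitely many cubes. With this criterion a face is recognised as a polytope
  without exhibiting its boxes.\<close>

lemma pure_orthogonal_polytope_iff: "pure_orthogonal_polytope d P \<longleftrightarrow> compact P \<and> locally_conic d P"
proof
  assume P: "pure_orthogonal_polytope d P"
  obtain \<B> where B: "finite \<B>" "\<forall>B\<in>\<B>. pure_box d B" "P = \<Union>\<B>"
    using P unfolding pure_orthogonal_polytope_def by blast
  have "compact B \<and> B \<subseteq> Rn d" if BB: "B \<in> \<B>" for B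
  proof -
    obtain a b where "B = aabox d a b" using B(2) BB unfolding pure_box_def by blast
    then show ?thesis using compact_aabox[of d a b] by (auto simp: aabox_def)
  qed
  then have "compact P" "P \<subseteq> Rn d" using compact_Union[OF B(1)] B(3) by (simp, blast)
  then show "compact P \<and> locally_conic d P"
    using pure_orthogonal_polytope_germ[OF P] unfolding locally_conic_def by blast
next
  assume P: "compact P \<and> locally_conic d P"
  then have PR: "P \<subseteq> Rn d" unfolding locally_conic_def by blast
  from P have "\<forall>v\<in>P. \<exists>f \<delta>. germ d P v f \<delta>" unfolding locally_conic_def by blast
  then obtain f where "\<forall>v\<in>P. \<exists>\<delta>. germ d P v (f v) \<delta>" by metis
  then obtain \<delta> where g: "\<And>v. v \<in> P \<Longrightarrow> germ d P v (f v) (\<delta> v)" by metis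
  define box where "box v S = aabox d (\<lambda>i. if i \<in> S then v i else v i - \<delta> v)
    (\<lambda>i. if i \<in> S then v i + \<delta> v else v i)" for v S
  define N where "N v = box v ` {S \<in> Pow {..<d}. f v (\<lambda>i. i \<in> S)}" for v
  have fN: "finite (N v)" for v unfolding N_def by simp
  have pN: "pure_box d B" if v: "v \<in> P" and B: "B \<in> N v" for v B
  proof -
    obtain S where "B = box v S" using B unfolding N_def by blast
    then show ?thesis using germD(2)[OF g[OF v]] unfolding box_def pure_box_def
      by (intro exI conjI) auto
  qed
  have cube: "(\<forall>i<d. \<bar>x i - v i\<bar> \<le> \<delta> v) \<and> (\<exists>b. restr (pdiff x v) (f v) b)"
    if v: "v \<in> P" and x: "x \<in> \<Union>(N v)" for x v
  proof -
    have d: "0 < \<delta> v" using germD(2)[OF g[OF v]] .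
    obtain S where S: "x \<in> box v S" "f v (\<lambda>i. i \<in> S)" using x unfolding N_def by blast
    have i: "\<bar>x i - v i\<bar> \<le> \<delta> v \<and> (i \<in> S \<longrightarrow> x i \<ge> v i) \<and> (i \<notin> S \<longrightarrow> x i \<le> v i)" if "i < d" for i
      using S(1) that d unfolding box_def aabox_def by (auto split: if_splits)
    have "f v (signfix (pdiff x v) (\<lambda>i. i \<in> S)) = f v (\<lambda>i. i \<in> S)"
    proof (rule readsD[OF germD(1)[OF g[OF v]]])
      fix j assume "j \<in> {..<d}"
      then show "signfix (pdiff x v) (\<lambda>i. i \<in> S) j = (j \<in> S)"
        using i[of j] by (auto simp: signfix_def pdiff_def)
    qed
    then show ?thesis using i S(2) unfolding restr_def by blast
  qed
  have sub: "\<Union>(N v) \<subseteq> P" if v: "v \<in> P" for v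
  proof
    fix x assume x: "x \<in> \<Union>(N v)"
    then have "x \<in> Rn d" unfolding N_def box_def aabox_def by blast
    with germD(4)[OF g[OF v] this] cube[OF v x] show "x \<in> P" by blast
  qed
  have sup: "P \<inter> open_box d v (\<delta> v) \<subseteq> \<Union>(N v)" if v: "v \<in> P" for v
  proof
    fix x assume x: "x \<in> P \<inter> open_box d v (\<delta> v)"
    then have xR: "x \<in> Rn d" and xv: "\<And>i. i < d \<Longrightarrow> \<bar>x i - v i\<bar> < \<delta> v"
      using PR unfolding open_box_def by auto
    then obtain b where b: "f v (signfix (pdiff x v) b)"
      using germD(4)[OF g[OF v] xR] x unfolding restr_def by (meson IntD1 less_imp_le)
    define S where "S = {i. i < d \<and> signfix (pdiff x v) b i}"
    have "f v (\<lambda>i. i \<in> S) = f v (signfix (pdiff x v) b)"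
      by (rule readsD[OF germD(1)[OF g[OF v]]]) (simp add: S_def)
    then have "box v S \<in> N v" unfolding N_def using b by (auto simp: S_def)
    moreover have "x \<in> box v S"
      unfolding box_def aabox_def
      using xR xv by (force simp: S_def signfix_def pdiff_def abs_less_iff)
    ultimately show "x \<in> \<Union>(N v)" by blast
  qed
  obtain C where C: "C \<subseteq> P" "finite C" "P \<subseteq> (\<Union>v\<in>C. open_box d v (\<delta> v))"
  proof (rule compactE_image[of P P "\<lambda>v. open_box d v (\<delta> v)"])
    show "P \<subseteq> (\<Union>v\<in>P. open_box d v (\<delta> v))" using mem_open_box germD(2)[OF g] by blast
  qed (use P open_open_box in auto)
  have "P = \<Union>(\<Union>(N ` C))"
  proof (intro equalityI subsetI)
    fix x assume "x \<in> P"
    then obtain v where "v \<in> C" "x \<in> P \<inter> open_box d v (\<delta> v)" using C(3) by blast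
    then show "x \<in> \<Union>(\<Union>(N ` C))" using sup[of v] C(1) by blast
  next
    fix x assume "x \<in> \<Union>(\<Union>(N ` C))"
    then obtain v where "v \<in> C" "x \<in> \<Union>(N v)" by blast
    then show "x \<in> P" using sub[of v] C(1) by blast
  qed
  moreover have "finite (\<Union>(N ` C))" using C(2) fN by blast
  moreover have "\<forall>B\<in>\<Union>(N ` C). pure_box d B" using pN C(1) by blast
  ultimately show "pure_orthogonal_polytope d P" unfolding pure_orthogonal_polytope_def by blast
qed

subsection \<open>Genericity regions\<close>

text \<open>Wherever a germ exists, \<open>germ_unique\<close> leaves only one candidate.\<close>

definition local_fun :: "nat \<Rightarrow> (nat \<Rightarrow> real) set \<Rightarrow> (nat \<Rightarrow> real) \<Rightarrow> (nat \<Rightarrow> bool) \<Rightarrow> bool" where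
  "local_fun d P v = (SOME f. \<exists>\<delta>. germ d P v f \<delta>)"

lemma local_fun_eq:
  assumes "germ d P v f \<delta>"
  shows "local_fun d P v = f"
  unfolding local_fun_def
proof (rule some_equality)
  show "\<exists>\<delta>. germ d P v f \<delta>" using assms by blast
  show "g = f" if "\<exists>\<delta>. germ d P v g \<delta>" for g using germ_unique[OF assms] that by blast
qed

lemma locally_conic_germ:
  assumes "locally_conic d P" "v \<in> P"
  obtains \<delta> where "germ d P v (local_fun d P v) \<delta>"
proof -
  obtain f \<delta> where "germ d P v f \<delta>" using assms unfolding locally_conic_def by blast
  then show thesis using local_fun_eq that by metis
qed

text \<open>Makes transitivity of path components available.\<close>

lemma genericity_region_eq:
  "genericity_region d P v = path_component_set
     {x \<in> P. congruent_cones d (tangent_cone d P x) (tangent_cone d P v)} v"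
proof (intro set_eqI iffI)
  fix w assume "w \<in> genericity_region d P v"
  then show "w \<in> path_component_set {x \<in> P. congruent_cones d (tangent_cone d P x) (tangent_cone d P v)} v"
    unfolding genericity_region_def path_component_def by blast
next
  fix w assume "w \<in> path_component_set {x \<in> P. congruent_cones d (tangent_cone d P x) (tangent_cone d P v)} v"
  then obtain g where g: "path g" "pathstart g = v" "pathfinish g = w"
    "path_image g \<subseteq> {x \<in> P. congruent_cones d (tangent_cone d P x) (tangent_cone d P v)}"
    unfolding path_component_def by blast
  moreover have "w \<in> path_image g" using g(3) pathfinish_in_path_image by blast
  ultimately show "w \<in> genericity_region d P v" unfolding genericity_region_def by blast
qed

lemma genericity_region_refl: "v \<in> P \<Longrightarrow> v \<in> genericity_region d P v"
  unfolding genericity_region_eq by (simp add: congruent_cones_refl path_component_refl)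

lemma genericity_region_subset: "genericity_region d P v \<subseteq> P"
  unfolding genericity_region_def by blast

text \<open>The function and its frozen coordinates are locally constant along the path: a nearby
  cone is a substitution instance with equally many essential signs, so no essential sign was
  substituted. The path image is connected, hence both are constant.\<close>

lemma genericity_region_const:
  assumes P: "locally_conic d P" and v: "v \<in> P" and w: "w \<in> genericity_region d P v"
  shows "local_fun d P w = local_fun d P v" "\<And>i. i \<in> dep (local_fun d P v) \<Longrightarrow> w i = v i"
proof -
  let ?f = "local_fun d P"
  \<comment> \<open>Inessential coordinates are masked by 0, since they may vary along the
    path.\<close>
  define \<phi> where "\<phi> = (\<lambda>x. (?f x, \<lambda>i. if i \<in> dep (?f x) then x i else 0))"
  obtain g where g: "path g" "pathstart g = v" "pathfinish g = w" "path_image g \<subseteq> P"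
    and c: "\<And>x. x \<in> path_image g \<Longrightarrow> congruent_cones d (tangent_cone d P x) (tangent_cone d P v)"
    using w unfolding genericity_region_def by blast
  obtain \<delta>v where gv: "germ d P v (?f v) \<delta>v" using locally_conic_germ[OF P v] .
  have card: "card (dep (?f x)) = card (dep (?f v))" if "x \<in> path_image g" for x
  proof -
    obtain \<delta> where gx: "germ d P x (?f x) \<delta>" using locally_conic_germ[OF P] \<open>x \<in> path_image g\<close> g(4)
      by blast
    then show ?thesis
      using c[OF \<open>x \<in> path_image g\<close>] tangent_cone_eq[OF gx] tangent_cone_eq[OF gv]
        congruent_cones_card_dep[OF germD(1)[OF gx] germD(1)[OF gv]] by simp
  qed
  have "\<phi> constant_on path_image g"
  proof (rule locally_constant_imp_constant)
    show "connected (path_image g)" using g(1) by (rule connected_path_image)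
    fix a assume a: "a \<in> path_image g"
    obtain \<delta> where ga: "germ d P a (?f a) \<delta>" using locally_conic_germ[OF P] a g(4) by blast
    show "\<exists>T. openin (top_of_set (path_image g)) T \<and> a \<in> T \<and> (\<forall>x\<in>T. \<phi> x = \<phi> a)"
    proof (intro exI conjI ballI)
      show "openin (top_of_set (path_image g)) (path_image g \<inter> open_box d a \<delta>)"
        using open_open_box by (rule openin_open_Int)
      show "a \<in> path_image g \<inter> open_box d a \<delta>" using a mem_open_box germD(2)[OF ga] by blast
      fix x assume x: "x \<in> path_image g \<inter> open_box d a \<delta>"
      then have "x \<in> Rn d" using g(4) P unfolding locally_conic_def by blast
      then obtain \<epsilon> where "germ d P x (restr (pdiff x a) (?f a)) \<epsilon>"
        using germ_shift[OF ga] x unfolding open_box_def by blast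
      then have fx: "?f x = restr (pdiff x a) (?f a)" by (rule local_fun_eq)
      then have "card (dep (restr (pdiff x a) (?f a))) = card (dep (?f a))"
        using card[of x] card[of a] x a by simp
      from restr_eq_if_card_dep[OF germD(1)[OF ga] finite_lessThan this]
      show "\<phi> x = \<phi> a" unfolding \<phi>_def fx by (auto simp: pdiff_def)
    qed
  qed
  moreover have "v \<in> path_image g" "w \<in> path_image g"
    using g(2,3) pathstart_in_path_image pathfinish_in_path_image by blast+
  ultimately have e: "\<phi> w = \<phi> v" unfolding constant_on_def by metis
  then show 1: "?f w = ?f v" unfolding \<phi>_def by simp
  show "w i = v i" if "i \<in> dep (?f v)" for i
  proof -
    have "snd (\<phi> w) i = snd (\<phi> v) i" using e by simp
    then show ?thesis using that unfolding \<phi>_def 1 by simp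
  qed
qed

text \<open>Within one germ a segment is an admissible path once all its points have the function of
  \<open>v\<close>: equal functions give equal cones, and membership in \<open>P\<close> depends on
  the function alone.\<close>

lemma genericity_region_segment:
  assumes P: "locally_conic d P" and v: "v \<in> P" and g: "germ d P w f \<delta>"
    and x: "x \<in> genericity_region d P v" "x \<in> open_box d w \<delta>"
    and y: "y \<in> Rn d" "y \<in> open_box d w \<delta>"
    and f: "\<And>t. 0 \<le> t \<Longrightarrow> t \<le> 1 \<Longrightarrow> restr (pdiff (\<lambda>i. (1 - t) * x i + t * y i) w) f = local_fun d P v"
  shows "y \<in> genericity_region d P v"
proof -
  let ?S = "{x \<in> P. congruent_cones d (tangent_cone d P x) (tangent_cone d P v)}"
  define p where "p = (\<lambda>t i. (1 - t) * x i + t * y i)"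
  have xR: "x \<in> Rn d" using x(1) genericity_region_subset P unfolding locally_conic_def by blast
  obtain \<delta>v where gv: "germ d P v (local_fun d P v) \<delta>v" using locally_conic_germ[OF P v] .
  have pS: "p t \<in> ?S" if t: "t \<in> {0..1}" for t
  proof -
    have pR: "p t \<in> Rn d" using xR y(1) unfolding p_def Rn_def by simp
    have "\<bar>p t i - w i\<bar> < \<delta>" if i: "i < d" for i
    proof -
      have "p t i - w i = (1 - t) * (x i - w i) + t * (y i - w i)"
        unfolding p_def by (simp add: algebra_simps)
      moreover have "(1 - t) *\<^sub>R (x i - w i) + t *\<^sub>R (y i - w i) \<in> ball 0 \<delta>"
        using x(2) y(2) i t unfolding open_box_def
        by (intro convexD[OF convex_ball]) (auto simp: dist_real_def)
      ultimately show ?thesis by (simp add: dist_real_def)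
    qed
    then obtain \<epsilon> where "germ d P (p t) (restr (pdiff (p t) w) f) \<epsilon>"
      using germ_shift[OF g pR] by blast
    moreover have "restr (pdiff (p t) w) f = local_fun d P v"
      using f[of t] t unfolding p_def by simp
    ultimately have gp: "germ d P (p t) (local_fun d P v) \<epsilon>" by simp
    show ?thesis
      using germ_mem[OF gp] germ_mem[OF gv] v tangent_cone_eq[OF gp] tangent_cone_eq[OF gv] congruent_cones_refl by simp
  qed
  have "path p" unfolding path_def p_def
    by (intro continuous_on_coordinatewise_then_product continuous_intros)
  moreover have "path_image p \<subseteq> ?S" using pS unfolding path_image_def by blast
  moreover have "pathstart p = x" "pathfinish p = y"
    unfolding p_def pathstart_def pathfinish_def by auto
  ultimately have "path_component ?S x y" unfolding path_component_def by blast
  then show ?thesis using x(1) path_component_trans unfolding genericity_region_eq by blast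
qed

text \<open>A small move along an inessential coordinate leaves the cone unchanged and stays in the
  region, so no containing hyperplane fixes that coordinate.\<close>

lemma genericity_region_hyperplane:
  assumes P: "locally_conic d P" and v: "v \<in> P" and I: "I \<subseteq> {..<d}"
    and R: "genericity_region d P v \<subseteq> gen_hyperplane d I l"
  shows "I \<subseteq> dep (local_fun d P v)"
proof
  fix i assume i: "i \<in> I"
  let ?f = "local_fun d P v"
  obtain \<delta> where g: "germ d P v ?f \<delta>" using locally_conic_germ[OF P v] .
  note d = germD(2)[OF g]
  show "i \<in> dep ?f"
  proof (rule ccontr)
    assume ni: "i \<notin> dep ?f"
    define y where "y = v(i := v i + \<delta> / 2)"
    have "y \<in> genericity_region d P v"
    proof (rule genericity_region_segment[OF P v g genericity_region_refl[OF v]])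
      show "v \<in> open_box d v \<delta>" using d by (rule mem_open_box)
      show "y \<in> open_box d v \<delta>" using d unfolding open_box_def y_def by simp
      show "y \<in> Rn d" using germD(3)[OF g] i I unfolding y_def Rn_def by auto
      fix t :: real
      show "restr (pdiff (\<lambda>i. (1 - t) * v i + t * y i) v) ?f = ?f"
        by (rule restr_eq[OF reads_dep[OF germD(1)[OF g]]]) (use ni in \<open>auto simp: pdiff_def y_def algebra_simps\<close>)
    qed
    then have "y i = l i" "v i = l i"
      using R i genericity_region_refl[OF v] unfolding gen_hyperplane_def by auto
    then show False using d unfolding y_def by simp
  qed
qed

text \<open>The hyperplane that freezes exactly the essential coordinates contains the region, and
  every other containing one freezes only some of them.\<close>

lemma region_degree_eq:
  assumes P: "locally_conic d P" and v: "v \<in> P"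
  shows "region_degree d (genericity_region d P v) = d - card (dep (local_fun d P v))"
  unfolding region_degree_def
proof (rule Least_equality)
  let ?f = "local_fun d P v"
  obtain \<delta> where g: "germ d P v ?f \<delta>" using locally_conic_germ[OF P v] .
  have fd: "dep ?f \<subseteq> {..<d}" using dep_subset[OF germD(1)[OF g]] .
  have "genericity_region d P v \<subseteq> gen_hyperplane d (dep ?f) v"
    using genericity_region_const(2)[OF P v] genericity_region_subset P
    unfolding gen_hyperplane_def locally_conic_def by blast
  with fd show "\<exists>I l. I \<subseteq> {..<d} \<and> d - card (dep ?f) = d - card I \<and> genericity_region d P v \<subseteq> gen_hyperplane d I l"
    by blast
  fix m assume "\<exists>I l. I \<subseteq> {..<d} \<and> m = d - card I \<and> genericity_region d P v \<subseteq> gen_hyperplane d I l"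
  then obtain I l
    where I: "I \<subseteq> {..<d}" "m = d - card I" "genericity_region d P v \<subseteq> gen_hyperplane d I l" by blast
  have "I \<subseteq> dep ?f" by (rule genericity_region_hyperplane[OF P v I(1,3)])
  then have "card I \<le> card (dep ?f)" using fd finite_subset by (intro card_mono) blast+
  then show "d - card (dep ?f) \<le> m" unfolding I(2) by simp
qed

lemma singular_point_iff:
  assumes P: "locally_conic d P"
  shows "singular_point d P v \<longleftrightarrow> v \<in> P \<and> dep (local_fun d P v) = {..<d}"
proof (cases "v \<in> P")
  case True
  obtain \<delta> where g: "germ d P v (local_fun d P v) \<delta>" using locally_conic_germ[OF P True] .
  have fd: "dep (local_fun d P v) \<subseteq> {..<d}" using dep_subset[OF germD(1)[OF g]] .
  then have "d - card (dep (local_fun d P v)) = 0 \<longleftrightarrow> dep (local_fun d P v) = {..<d}"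
    using card_mono[OF finite_lessThan fd] card_subset_eq[OF finite_lessThan fd]
    by (metis card_lessThan diff_is_0_eq diff_self_eq_0 le_antisym)
  then show ?thesis unfolding singular_point_def region_degree_eq[OF P True] using True by blast
qed (simp add: singular_point_def)

subsection \<open>Floral vertices\<close>

text \<open>The signs at zero coordinates are chosen separately for the two cones, and disjointness
  lets the choices be combined. For a sign and its negation the cones meet in a hyperplane, whereas
  the conjunction is never satisfied.\<close>

lemma sign_cone_conj:
  assumes "reads A f" "reads B g" "A \<inter> B = {}"
  shows "sign_cone d (\<lambda>b. f b \<and> g b) = sign_cone d f \<inter> sign_cone d g"
proof (intro equalityI subsetI)
  fix x assume "x \<in> sign_cone d f \<inter> sign_cone d g"
  then obtain b b' where b: "x \<in> Rn d" "f (signfix x b)" "g (signfix x b')"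
    unfolding sign_cone_def restr_def by blast
  let ?b = "override_on b' b A"
  have "f (signfix x ?b) = f (signfix x b)"
    by (rule readsD[OF assms(1)]) (simp add: signfix_def)
  moreover have "g (signfix x ?b) = g (signfix x b')"
    by (rule readsD[OF assms(2)]) (use assms(3) in \<open>auto simp: signfix_def override_on_def\<close>)
  ultimately show "x \<in> sign_cone d (\<lambda>b. f b \<and> g b)"
    using b unfolding sign_cone_def restr_def by blast
qed (auto simp: sign_cone_def restr_def)

lemma sign_cone_disj: "sign_cone d (\<lambda>b. f b \<or> g b) = sign_cone d f \<union> sign_cone d g"
  by (auto simp: sign_cone_def restr_def)

lemma sign_cone_lit:
  assumes "s i = 1 \<or> s i = -1"
  shows "interpret_spd d s (Edge i) = sign_cone d (\<lambda>b. b i = (s i = 1))"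
proof (intro equalityI subsetI)
  fix x assume "x \<in> interpret_spd d s (Edge i)"
  then obtain y where y: "y \<in> Rn d" "y i \<ge> 0" "x = (\<lambda>j. s i * y j)" by (auto simp: half_space_def)
  then have "x \<in> Rn d" by (simp add: Rn_def)
  moreover have "signfix x (\<lambda>_. s i = 1) i = (s i = 1)"
    using assms y(2,3) by (auto simp: signfix_def)
  ultimately show "x \<in> sign_cone d (\<lambda>b. b i = (s i = 1))" unfolding sign_cone_def restr_def by blast
next
  fix x assume "x \<in> sign_cone d (\<lambda>b. b i = (s i = 1))"
  then obtain b
    where x: "x \<in> Rn d" "signfix x b i = (s i = 1)" unfolding sign_cone_def restr_def by blast
  have "(\<lambda>j. s i * x j) \<in> half_space d i"
    using x assms by (auto simp: half_space_def Rn_def signfix_def)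
  moreover have "x = (\<lambda>j. s i * (s i * x j))" using assms by (auto simp: fun_eq_iff)
  ultimately show "x \<in> interpret_spd d s (Edge i)" by auto
qed

lemma interpret_spd_read_once:
  assumes "is_spd D" "edges D \<noteq> {}" "edges D \<subseteq> {..<d}" "signs d s"
  shows "\<exists>f. read_once (\<lambda>i. s i = 1) (edges D) f \<and> interpret_spd d s D = sign_cone d f"
  using assms
proof (induction D)
  case (Edge i)
  then have "s i = 1 \<or> s i = -1" unfolding signs_def by auto
  from sign_cone_lit[of s i, OF this] read_once.lit[of "\<lambda>i. s i = 1" i] show ?case
    by (metis spd.set(2))
next
  case (Series D1 D2)
  then obtain f g
    where fg: "read_once (\<lambda>i. s i = 1) (edges D1) f" "interpret_spd d s D1 = sign_cone d f"
    "read_once (\<lambda>i. s i = 1) (edges D2) g" "interpret_spd d s D2 = sign_cone d g" by auto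
  have "edges D1 \<inter> edges D2 = {}" using Series by simp
  with read_once.conj[OF fg(1,3)] sign_cone_conj[OF read_once_reads[OF fg(1)] read_once_reads[OF fg(3)]] fg
  show ?case by (intro exI[of _ "\<lambda>b. f b \<and> g b"]) simp
next
  case (Parallel D1 D2)
  then obtain f g
    where fg: "read_once (\<lambda>i. s i = 1) (edges D1) f" "interpret_spd d s D1 = sign_cone d f"
    "read_once (\<lambda>i. s i = 1) (edges D2) g" "interpret_spd d s D2 = sign_cone d g" by auto
  have "edges D1 \<inter> edges D2 = {}" using Parallel by simp
  with read_once.disj[OF fg(1,3)] sign_cone_disj[of d f g] fg
  show ?case by (intro exI[of _ "\<lambda>b. f b \<or> g b"]) simp
qed simp

lemma read_once_interpret_spd:
  "read_once c A f \<Longrightarrow> (\<And>i. s i = (if c i then 1 else -1)) \<Longrightarrow>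
   \<exists>D. is_spd D \<and> edges D = A \<and> interpret_spd d s D = sign_cone d f"
proof (induction rule: read_once.induct)
  case (lit i)
  then have "s i = 1 \<or> s i = -1" "(s i = 1) = c i" by auto
  with sign_cone_lit[of s i d] show ?case by (intro exI[of _ "Edge i"]) simp
next
  case (conj A f B g)
  then obtain D1 D2 where "is_spd D1" "edges D1 = A" "interpret_spd d s D1 = sign_cone d f"
    "is_spd D2" "edges D2 = B" "interpret_spd d s D2 = sign_cone d g" by blast
  with conj.hyps show ?case
    using sign_cone_conj[OF read_once_reads read_once_reads, of c A f c B g d]
      read_once_nonempty[OF conj.hyps(1)] read_once_nonempty[OF conj.hyps(2)]
    by (intro exI[of _ "Series D1 D2"]) auto
next
  case (disj A f B g)
  then obtain D1 D2 where "is_spd D1" "edges D1 = A" "interpret_spd d s D1 = sign_cone d f"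
    "is_spd D2" "edges D2 = B" "interpret_spd d s D2 = sign_cone d g" by blast
  with disj.hyps show ?case
    using sign_cone_disj[of d f g]
      read_once_nonempty[OF disj.hyps(1)] read_once_nonempty[OF disj.hyps(2)]
    by (intro exI[of _ "Parallel D1 D2"]) auto
qed

text \<open>The constant True comes from the diagram \<open>Vertex\<close>, which forces
  \<open>d = 0\<close>.\<close>

lemma floral_vertex_read_once:
  assumes "floral_vertex d A"
  shows "\<exists>f. reads {..<d} f \<and> A = sign_cone d f \<and> (f = (\<lambda>_. True) \<or> (\<exists>c. read_once c {..<d} f))"
proof -
  obtain D s where D: "is_spd D" "edges D = {..<d}" "signs d s" "A = interpret_spd d s D"
    using assms unfolding floral_vertex_def by blast
  show ?thesis
  proof (cases "d = 0")
    case True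
    then have "edges D = {}" using D(2) by simp
    then have "D = Vertex" using D(1) by (cases D) simp_all
    then have "A = sign_cone d (\<lambda>_. True)" using D(4) by (simp add: sign_cone_def restr_def)
    then show ?thesis by (intro exI[of _ "\<lambda>_. True"]) (simp add: reads_def)
  next
    case False
    then have "edges D \<noteq> {}" using D(2) by auto
    with interpret_spd_read_once[OF D(1) this _ D(3)] D(2,4) obtain f
      where "read_once (\<lambda>i. s i = 1) {..<d} f" "A = sign_cone d f" by auto
    then show ?thesis using read_once_reads by blast
  qed
qed

lemma read_once_floral_vertex:
  assumes "read_once c {..<d} f" shows "floral_vertex d (sign_cone d f)"
proof -
  let ?s = "\<lambda>i. if c i then 1 else -1 :: real"
  obtain D where "is_spd D" "edges D = {..<d}" "interpret_spd d ?s D = sign_cone d f"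
    using read_once_interpret_spd[OF assms, of ?s d] by blast
  moreover have "signs d ?s" unfolding signs_def by simp
  ultimately show ?thesis unfolding floral_vertex_def by metis
qed

lemma floral_vertex_0: "floral_vertex 0 (sign_cone 0 (\<lambda>_. True))"
  unfolding floral_vertex_def
  by (intro exI[of _ Vertex] exI[of _ "\<lambda>_. 1"]) (simp add: signs_def sign_cone_def restr_def)

subsection \<open>Faces\<close>

lemma generic_orthotopeD:
  assumes "generic_orthotope d P"
  shows "compact P" "locally_conic d P" "\<And>v. singular_point d P v \<Longrightarrow> floral_vertex d (tangent_cone d P v)"
  using assms unfolding generic_orthotope_def pure_orthogonal_polytope_iff by auto

lemma closure_genericity_region_subset:
  assumes "compact P"
  shows "closure (genericity_region d P v) \<subseteq> P"
  using genericity_region_subset closure_minimal compact_imp_closed[OF assms] by blast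

lemma closed_coordinate: "closed {x :: nat \<Rightarrow> real. x i = c}"
  by (intro closed_Collect_eq continuous_on_product_coordinates continuous_on_const)

lemma closure_genericity_region_const:
  assumes "locally_conic d P" "v \<in> P" "w \<in> closure (genericity_region d P v)" "i \<in> dep (local_fun d P v)"
  shows "w i = v i"
proof -
  have "genericity_region d P v \<subseteq> {x. x i = v i}"
    using genericity_region_const(2)[OF assms(1,2) _ assms(4)] by blast
  then have "closure (genericity_region d P v) \<subseteq> {x. x i = v i}"
    using closed_coordinate by (rule closure_minimal)
  then show ?thesis using assms(3) by blast
qed

lemma open_box_meets_region:
  assumes "w \<in> closure R" "0 < e"
  obtains x where "x \<in> R" "x \<in> open_box d w e"
proof -
  have "open_box d w e \<inter> R \<noteq> {}"
    using open_Int_closure_eq_empty[OF open_open_box, of d w e R] mem_open_box[OF assms(2), of w d]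
      assms(1) by blast
  then show thesis using that by blast
qed

text \<open>
  Every point lies on a face whose closure contains a vertex. Instead of a vertex, it suffices to
  reach a point with more variables: maximise a free coordinate over the closure of the region.
\<close>

lemma local_fun_read_once:
  assumes P: "generic_orthotope d P" and v: "v \<in> P"
  shows "local_fun d P v = (\<lambda>_. True) \<or> (\<exists>c A. read_once c A (local_fun d P v))"
  using v
proof (induction "d - card (dep (local_fun d P v))" arbitrary: v rule: less_induct)
  case less
  let ?f = "local_fun d P"
  note cP = generic_orthotopeD(1)[OF P] and lP = generic_orthotopeD(2)[OF P]
  obtain \<delta>v where gv: "germ d P v (?f v) \<delta>v" using locally_conic_germ[OF lP less.prems] .
  have vd: "dep (?f v) \<subseteq> {..<d}" using dep_subset[OF germD(1)[OF gv]] .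
  show ?case
  proof (cases "dep (?f v) = {..<d}")
    case True
    then have "floral_vertex d (tangent_cone d P v)"
      using singular_point_iff[OF lP] less.prems generic_orthotopeD(3)[OF P] by blast
    then obtain f where f: "reads {..<d} f" "sign_cone d (?f v) = sign_cone d f"
      "f = (\<lambda>_. True) \<or> (\<exists>c. read_once c {..<d} f)"
      using floral_vertex_read_once tangent_cone_eq[OF gv] by metis
    then have "?f v = f" using sign_cone_inj[OF germD(1)[OF gv]] by blast
    then show ?thesis using f(3) by blast
  next
    case False
    then obtain i where i: "i < d" "i \<notin> dep (?f v)" using vd by blast
    let ?R = "genericity_region d P v"
    have "compact (closure ?R)"
      using closure_genericity_region_subset[OF cP] cP compact_closure closed_closure
      by (metis compact_Int_closed inf.absorb_iff2)
    moreover have "closure ?R \<noteq> {}"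
      using genericity_region_refl[OF less.prems] closure_subset by blast
    moreover have "continuous_on (closure ?R) (\<lambda>x. x i)"
      by (rule continuous_on_subset[OF continuous_on_product_coordinates subset_UNIV])
    ultimately obtain w where w: "w \<in> closure ?R" and wmax: "\<And>x. x \<in> closure ?R \<Longrightarrow> x i \<le> w i"
      using continuous_attains_sup[of "closure ?R" "\<lambda>x. x i"] by blast
    have wP: "w \<in> P" using w closure_genericity_region_subset[OF cP] by blast
    obtain \<delta> where gw: "germ d P w (?f w) \<delta>" using locally_conic_germ[OF lP wP] .
    have wd: "dep (?f w) \<subseteq> {..<d}" using dep_subset[OF germD(1)[OF gw]] .
    obtain x
      where x: "x \<in> ?R" "x \<in> open_box d w \<delta>" using open_box_meets_region[OF w germD(2)[OF gw]] .
    have xR: "x \<in> Rn d" using x(1) genericity_region_subset lP unfolding locally_conic_def by blast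
    obtain \<epsilon> where "germ d P x (restr (pdiff x w) (?f w)) \<epsilon>"
      using germ_shift[OF gw xR] x(2) unfolding open_box_def by blast
    then have fr: "?f v = restr (pdiff x w) (?f w)"
      using local_fun_eq genericity_region_const(1)[OF lP less.prems x(1)] by simp
    \<comment> \<open>Otherwise a region point near \<open>w\<close> could be pushed in coordinate
      \<open>i\<close> beyond the maximum \<open>w i\<close> without changing its cone.\<close>
    have iw: "i \<in> dep (?f w)"
    proof (rule ccontr)
      assume iw: "i \<notin> dep (?f w)"
      define y where "y = x(i := w i + \<delta> / 2)"
      have "y \<in> ?R"
      proof (rule genericity_region_segment[OF lP less.prems gw x])
        show "y \<in> Rn d" using xR i(1) unfolding y_def Rn_def by auto
        show "y \<in> open_box d w \<delta>" using x(2) germD(2)[OF gw] unfolding y_def open_box_def by auto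
        fix t :: real
        show "restr (pdiff (\<lambda>i. (1 - t) * x i + t * y i) w) (?f w) = ?f v"
          unfolding fr by (rule restr_cong[OF reads_dep[OF germD(1)[OF gw]]])
            (use iw in \<open>auto simp: pdiff_def y_def algebra_simps\<close>)
      qed
      then have "y i \<le> w i" using wmax closure_subset by blast
      then show False using germD(2)[OF gw] unfolding y_def by simp
    qed
    have "dep (?f v) \<subset> dep (?f w)" using dep_restr[of "pdiff x w" "?f w"] fr iw i(2) by auto
    then have c: "card (dep (?f v)) < card (dep (?f w))"
      using wd finite_subset by (intro psubset_card_mono) blast+
    have "card (dep (?f w)) \<le> d" using card_mono[OF finite_lessThan wd] by simp
    then have "?f w = (\<lambda>_. True) \<or> (\<exists>c A. read_once c A (?f w))"
      using c by (intro less.hyps wP) linarith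
    \<comment> \<open>The function at \<open>v\<close> is a restriction of the one at
      \<open>w\<close>. Of the two constants, False is impossible because \<open>v\<close> lies in
      \<open>P\<close>.\<close>
    then have "(\<exists>t. ?f v = (\<lambda>_. t)) \<or> (\<exists>c A. read_once c A (?f v))"
      unfolding fr using read_once_restr by (metis restr_def)
    moreover have "?f v \<noteq> (\<lambda>_. False)" using germ_mem[OF gv] less.prems by auto
    ultimately show ?thesis by (metis (full_types))
  qed
qed

text \<open>
  Near a point \<open>w\<close> of the face, \<open>f\<close> being the Boolean function of the tangent cone at \<open>w\<close>, the
  region consists of the points where substituting the signs of the displacement into \<open>f\<close> yields
  the function of the region. The sign vectors that do so form the slice \<open>h\<close>. Being monotone towards
  a centre, \<open>h\<close> makes this set star-shaped, so the region contains all of it or nothing.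
\<close>

lemma face_local:
  assumes P: "generic_orthotope d P" and v: "v \<in> P" and I: "I = dep (local_fun d P v)"
    and w: "w \<in> closure (genericity_region d P v)"
  obtains h \<delta> where "reads ({..<d} - I) h" "0 < \<delta>"
    "h = (\<lambda>_. True) \<or> (\<exists>c A. A \<subseteq> {..<d} - I \<and> read_once c A h)"
    "\<And>x. x \<in> Rn d \<Longrightarrow> (\<And>i. i \<in> I \<Longrightarrow> x i = v i) \<Longrightarrow> x \<in> open_box d w \<delta> \<Longrightarrow>
      x \<in> closure (genericity_region d P v) \<longleftrightarrow> (\<exists>b. restr (pdiff x w) h b)"
proof -
  let ?R = "genericity_region d P v"
  note cP = generic_orthotopeD(1)[OF P] and lP = generic_orthotopeD(2)[OF P]
  define g where "g = local_fun d P v"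
  define f where "f = local_fun d P w"
  obtain \<delta>v where gv: "germ d P v g \<delta>v" using locally_conic_germ[OF lP v] unfolding g_def .
  have Ig: "I = dep g" unfolding I g_def ..
  have gI: "reads I g" unfolding Ig by (rule reads_dep[OF germD(1)[OF gv]]) simp
  have Id: "I \<subseteq> {..<d}" unfolding Ig using dep_subset[OF germD(1)[OF gv]] .
  have wP: "w \<in> P" using w closure_genericity_region_subset[OF cP] by blast
  obtain \<delta> where gw: "germ d P w f \<delta>" using locally_conic_germ[OF lP wP] unfolding f_def .
  note \<delta> = germD(2)[OF gw] and wR = germD(3)[OF gw]
  have wI: "w i = v i" if "i \<in> I" for i
    using closure_genericity_region_const[OF lP v w] that unfolding I by blast
  have RR: "x \<in> Rn d" if "x \<in> ?R" for x
    using that genericity_region_subset lP unfolding locally_conic_def by blast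
  have RI: "x i = v i" if "x \<in> ?R" "i \<in> I" for x i
    using genericity_region_const(2)[OF lP v that(1)] that(2) unfolding I by blast
  have Rg: "restr (pdiff x w) f = g" if x: "x \<in> ?R" "x \<in> open_box d w \<delta>" for x
  proof -
    obtain \<epsilon> where "germ d P x (restr (pdiff x w) f) \<epsilon>"
      using germ_shift[OF gw RR[OF x(1)]] x(2) unfolding open_box_def by blast
    then show ?thesis
      using local_fun_eq genericity_region_const(1)[OF lP v x(1)] unfolding g_def by metis
  qed
  obtain x0 where x0: "x0 \<in> ?R" "x0 \<in> open_box d w \<delta>" using open_box_meets_region[OF w \<delta>] .
  \<comment> \<open>Where \<open>x0\<close> and \<open>w\<close> agree outside \<open>I\<close>, the
    default is False. The function left on \<open>I\<close> is \<open>g\<close> for either value,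
    because \<open>g\<close> reads only \<open>I\<close>.\<close>
  define t0 where "t0 = (\<lambda>i. pdiff x0 w i > 0)"
  have gf: "f (override_on t0 b I) = g b" for b
  proof -
    have "signfix (pdiff x0 w) (override_on t0 b I) = override_on t0 b I"
      using RI[OF x0(1)] wI by (auto simp: signfix_def override_on_def t0_def pdiff_def fun_eq_iff)
    then have "f (override_on t0 b I) = g (override_on t0 b I)"
      unfolding Rg[OF x0, symmetric] restr_def by simp
    also have "\<dots> = g b" by (rule readsD[OF gI]) simp
    finally show ?thesis .
  qed
  define h where "h = slice I f t0"
  have h: "h t \<longleftrightarrow> (\<forall>\<beta>. f (override_on t \<beta> I) = g \<beta>)" for t unfolding h_def slice_def gf ..
  have If: "I \<subseteq> dep f" unfolding Ig using dep_restr[of "pdiff x0 w" f] Rg[OF x0] by auto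
  have fd: "dep f \<subseteq> {..<d}" using dep_subset[OF germD(1)[OF gw]] .
  have h_read: "reads ({..<d} - I) h"
    unfolding reads_def
  proof (intro allI impI)
    fix b b' :: "nat \<Rightarrow> bool" assume b: "\<forall>i\<in>{..<d} - I. b i = b' i"
    have "f (override_on b \<beta> I) = f (override_on b' \<beta> I)" for \<beta>
      by (rule readsD[OF germD(1)[OF gw]]) (use b in \<open>auto simp: override_on_def\<close>)
    then show "h b = h b'" unfolding h by simp
  qed
  have h_ro: "h = (\<lambda>_. True) \<or> (\<exists>c A. A \<subseteq> {..<d} - I \<and> read_once c A h)"
  proof -
    consider "f = (\<lambda>_. True)" | c A where "read_once c A f"
      using local_fun_read_once[OF P wP] unfolding f_def by blast
    then show ?thesis
    proof cases
      case 1
      then show ?thesis unfolding h_def slice_def by simp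
    next
      case (2 c A)
      have A: "A = dep f" using read_once_dep[OF 2] by simp
      have "(\<lambda>\<beta>. f (override_on t0 \<beta> I)) = g" using gf by blast
      \<comment> \<open>All of \<open>I\<close> is essential for \<open>g\<close>, the function that
        \<open>t0\<close> leaves of \<open>f\<close>; this is the premise of
        \<open>splits\<close>.\<close>
      then have "I \<inter> A \<subseteq> dep (\<lambda>\<beta>. f (override_on t0 \<beta> I))" using Ig by simp
      then have "h = (\<lambda>_. True) \<or> (\<exists>c. read_once c (A - I) h)"
        using read_once_splits[OF 2] unfolding splits_def h_def by blast
      moreover have "A - I \<subseteq> {..<d} - I" using A fd by blast
      ultimately show ?thesis by blast
    qed
  qed
  \<comment> \<open>A displacement into the region needs all orthants around it to be selected by
    \<open>h\<close>, whereas the closure will need only one.\<close>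
  have U: "restr y f = g \<longleftrightarrow> (\<forall>b. h (signfix y b))" if y: "\<And>i. i \<in> I \<Longrightarrow> y i = 0" for y
  proof
    assume r: "restr y f = g"
    show "\<forall>b. h (signfix y b)"
      unfolding h
    proof (intro allI)
      fix b \<beta>
      have "signfix y (override_on (signfix y b) \<beta> I) = override_on (signfix y b) \<beta> I"
        using y by (auto simp: signfix_def override_on_def fun_eq_iff)
      then have "f (override_on (signfix y b) \<beta> I) = g (override_on (signfix y b) \<beta> I)"
        unfolding r[symmetric] restr_def by simp
      also have "\<dots> = g \<beta>" by (rule readsD[OF gI]) simp
      finally show "f (override_on (signfix y b) \<beta> I) = g \<beta>" .
    qed
  next
    assume a: "\<forall>b. h (signfix y b)"
    show "restr y f = g"
    proof
      fix b
      have "override_on (signfix y b) b I = signfix y b"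
        using y by (auto simp: signfix_def override_on_def fun_eq_iff)
      then show "restr y f b = g b" using a unfolding h restr_def by metis
    qed
  qed
  have x0I: "pdiff x w i = 0" if "\<And>i. i \<in> I \<Longrightarrow> x i = v i" "i \<in> I" for x i
    using that wI unfolding pdiff_def by simp
  obtain c where c: "\<And>b b'. h b \<Longrightarrow> (\<And>i. i < d \<Longrightarrow> i \<notin> I \<Longrightarrow> b' i \<noteq> b i \<Longrightarrow> b' i = c i) \<Longrightarrow> h b'"
  proof (cases "h = (\<lambda>_. True)")
    case True
    then show thesis using that[of "\<lambda>_. True"] by simp
  next
    case False
    then obtain c A where cA: "A \<subseteq> {..<d} - I" "read_once c A h" using h_ro by blast
    show thesis
    proof (rule that[of c])
      fix b b' assume "h b" "\<And>i. i < d \<Longrightarrow> i \<notin> I \<Longrightarrow> b' i \<noteq> b i \<Longrightarrow> b' i = c i"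
      then show "h b'" using read_once_monotone[OF cA(2), of b b'] cA(1) by blast
    qed
  qed
  \<comment> \<open>The centre of the star: inside the open orthant of \<open>c\<close> in the free
    coordinates, and half the radius away from \<open>w\<close> to stay in the open box.\<close>
  define p where "p = (\<lambda>i. if i < d \<and> i \<notin> I then w i + (if c i then \<delta>/2 else - \<delta>/2) else w i)"
  have pR: "p \<in> Rn d" using wR unfolding p_def Rn_def by auto
  have pB: "p \<in> open_box d w \<delta>" using \<delta> unfolding p_def open_box_def by auto
  have pI: "p i = v i" if "i \<in> I" for i using that wI unfolding p_def by simp
  \<comment> \<open>On the way to \<open>p\<close> a free sign changes only towards that of
    \<open>c\<close>, so monotonicity preserves \<open>h\<close>.\<close>
  have star: "restr (pdiff (\<lambda>i. (1 - t) * x i + t * p i) w) f = g"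
    if x: "\<And>i. i \<in> I \<Longrightarrow> x i = v i" and r: "restr (pdiff x w) f = g" and t: "0 \<le> t" "t \<le> 1" for x t
  proof -
    let ?z = "\<lambda>i. (1 - t) * x i + t * p i"
    have zI: "?z i = v i" if "i \<in> I" for i using x[OF that] pI[OF that] by (simp add: algebra_simps)
    have hx: "h (signfix (pdiff x w) b)" for b using r U[of "pdiff x w"] x0I[OF x] by blast
    \<comment> \<open>The zero coordinates of the displacement of \<open>x\<close> are filled with
      the signs at \<open>?z\<close>, so the two sign vectors can differ only where that
      displacement is nonzero.\<close>
    have "h (signfix (pdiff ?z w) b)" for b
    proof (rule c[OF hx[of "signfix (pdiff ?z w) b"]])
      fix i assume i: "i < d" "i \<notin> I"
        and ne: "signfix (pdiff ?z w) b i \<noteq> signfix (pdiff x w) (signfix (pdiff ?z w) b) i"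
      have z: "pdiff ?z w i = (1 - t) * pdiff x w i + t * (if c i then \<delta>/2 else - \<delta>/2)"
        using i unfolding p_def pdiff_def by (simp add: algebra_simps)
      have "pdiff x w i \<noteq> 0" using ne by (auto simp: signfix_def)
      show "signfix (pdiff ?z w) b i = c i"
      proof (rule ccontr)
        assume nc: "signfix (pdiff ?z w) b i \<noteq> c i"
        show False
        proof (cases "c i")
          case True
          then have "pdiff ?z w i \<le> 0" "pdiff x w i > 0"
            using ne nc by (auto simp: signfix_def split: if_splits)
          moreover have "pdiff ?z w i > 0"
          proof (cases "t = 0")
            case False
            then have "t * (\<delta>/2) > 0" using t \<delta> by simp
            moreover have "(1 - t) * pdiff x w i \<ge> 0" using t \<open>pdiff x w i > 0\<close> by simp
            ultimately show ?thesis using z True by simp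
          qed (use z \<open>pdiff x w i > 0\<close> in simp)
          ultimately show False by simp
        next
          case False
          then have "pdiff ?z w i \<ge> 0" "pdiff x w i < 0"
            using ne nc by (auto simp: signfix_def split: if_splits)
          moreover have "pdiff ?z w i < 0"
          proof (cases "t = 0")
            case F: False
            then have "t * (\<delta>/2) > 0" using t \<delta> by simp
            moreover have "(1 - t) * pdiff x w i \<le> 0"
              using t \<open>pdiff x w i < 0\<close> by (simp add: mult_nonneg_nonpos)
            ultimately show ?thesis using z False by simp
          qed (use z \<open>pdiff x w i < 0\<close> in simp)
          ultimately show False by simp
        qed
      qed
    qed
    then show ?thesis using U[of "pdiff ?z w"] x0I[of ?z] zI by blast
  qed
  have pRg: "p \<in> ?R"
    using genericity_region_segment[OF lP v gw x0 pR pB] star[OF RI[OF x0(1)] Rg[OF x0]]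
    unfolding g_def by blast
  \<comment> \<open>Any point satisfying the condition is reached from \<open>p\<close> by running
    its segment backwards.\<close>
  have RU: "x \<in> ?R" if x: "x \<in> Rn d" "x \<in> open_box d w \<delta>" "\<And>i. i \<in> I \<Longrightarrow> x i = v i"
    and hx: "\<And>b. h (signfix (pdiff x w) b)" for x
  proof (rule genericity_region_segment[OF lP v gw pRg pB x(1,2)])
    fix t :: real assume t: "0 \<le> t" "t \<le> 1"
    have "restr (pdiff x w) f = g" using U[of "pdiff x w"] x0I[OF x(3)] hx by blast
    from star[OF x(3) this, of "1 - t"] t
    show "restr (pdiff (\<lambda>i. (1 - t) * p i + t * x i) w) f = local_fun d P v"
      unfolding g_def by (simp add: add.commute)
  qed
  have main: "x \<in> closure ?R \<longleftrightarrow> (\<exists>b. restr (pdiff x w) h b)"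
    if x: "x \<in> Rn d" "\<And>i. i \<in> I \<Longrightarrow> x i = v i" "x \<in> open_box d w \<delta>" for x
  proof
    assume xc: "x \<in> closure ?R"
    \<comment> \<open>A region point closer than \<open>e\<close> to \<open>x\<close> lies in the
      box around \<open>w\<close> and shares the nonzero signs of \<open>x\<close> relative to
      \<open>w\<close>.\<close>
    obtain e where e: "0 < e"
      "\<And>i. i \<in> {..<d} \<Longrightarrow> e \<le> min (\<delta> - \<bar>pdiff x w i\<bar>) (if pdiff x w i = 0 then 1 else \<bar>pdiff x w i\<bar>)"
      by (rule finite_pos_lower_bound[of "{..<d}"
            "\<lambda>i. min (\<delta> - \<bar>pdiff x w i\<bar>) (if pdiff x w i = 0 then 1 else \<bar>pdiff x w i\<bar>)"])
        (use x(3) in \<open>auto simp: pdiff_def open_box_def\<close>)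
    obtain x' where x': "x' \<in> ?R" "x' \<in> open_box d x e" using open_box_meets_region[OF xc e(1)] .
    have x'e: "\<bar>x' i - x i\<bar> < e" if "i < d" for i using x'(2) that unfolding open_box_def by blast
    have "\<bar>x' i - w i\<bar> < \<delta>" if "i < d" for i
      using x'e[OF that] e(2)[of i] that unfolding pdiff_def by auto
    then have x'w: "x' \<in> open_box d w \<delta>" unfolding open_box_def by blast
    have "restr (pdiff x' w) f = g" using Rg[OF x'(1) x'w] .
    then have hx': "h (signfix (pdiff x' w) b)" for b
      using U[of "pdiff x' w"] x0I[OF RI[OF x'(1)]] by blast
    \<comment> \<open>The signs at \<open>x'\<close> are selected by \<open>h\<close>, and they are
      compatible with \<open>x\<close>, so they serve as witness.\<close>
    let ?b = "signfix (pdiff x' w) (\<lambda>_. True)"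
    have "h (signfix (pdiff x w) ?b) = h ?b"
    proof (rule readsD[OF h_read])
      fix i assume "i \<in> {..<d} - I"
      then have "i < d" by blast
      then show "signfix (pdiff x w) ?b i = ?b i"
        using x'e[of i] e(2)[of i] by (auto simp: signfix_def pdiff_def split: if_splits)
    qed
    then show "\<exists>b. restr (pdiff x w) h b" unfolding restr_def using hx' by blast
  next
    assume "\<exists>b. restr (pdiff x w) h b"
    then obtain b where b: "h (signfix (pdiff x w) b)" unfolding restr_def by blast
    let ?s = "signfix (pdiff x w) b"
    obtain e where e: "0 < e" "\<And>i. i \<in> {..<d} \<Longrightarrow> e \<le> \<delta> - \<bar>pdiff x w i\<bar>"
      by (rule finite_pos_lower_bound[of "{..<d}" "\<lambda>i. \<delta> - \<bar>pdiff x w i\<bar>"])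
        (use x(3) in \<open>auto simp: pdiff_def open_box_def\<close>)
    \<comment> \<open>The denominators start at 2, so that \<open>r n\<close> is strictly below 1.
      The points \<open>z n\<close> move \<open>x\<close> into the open orthant of
      \<open>?s\<close>, where no free coordinate vanishes and the universal condition of the region
      reduces to \<open>h ?s\<close>.\<close>
    define r where "r n = inverse (real (Suc (Suc n)))" for n
    have r: "0 < r n" "r n < 1" for n unfolding r_def by (simp_all add: divide_simps)
    have er: "0 < e * r n" "e * r n < e" for n using r[of n] e(1) by auto
    define z
      where "z = (\<lambda>n i. x i + (if i < d \<and> i \<notin> I then (if ?s i then e else - e) * r n else 0))"
    have "z n \<in> ?R" for n
    proof (rule RU)
      show "z n \<in> Rn d" using x(1) unfolding z_def Rn_def by auto
      show "z n i = v i" if "i \<in> I" for i using x(2) that unfolding z_def by simp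
      show "z n \<in> open_box d w \<delta>"
        unfolding open_box_def
      proof (intro CollectI allI impI)
        fix i assume i: "i < d"
        have "\<bar>z n i - x i\<bar> < e" unfolding z_def using er[of n] e(1) by auto
        then show "\<bar>z n i - w i\<bar> < \<delta>" using e(2)[of i] i unfolding pdiff_def by auto
      qed
      show "h (signfix (pdiff (z n) w) b')" for b'
      proof -
        have "h (signfix (pdiff (z n) w) b') = h ?s"
        proof (rule readsD[OF h_read])
          fix i assume "i \<in> {..<d} - I"
          then have "pdiff (z n) w i = pdiff x w i + (if ?s i then e * r n else - (e * r n))"
            unfolding z_def pdiff_def by simp
          then show "signfix (pdiff (z n) w) b' i = ?s i"
            using er[of n] by (auto simp: signfix_def split: if_splits)
        qed
        then show ?thesis using b by simp
      qed
    qed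
    moreover have "z \<longlonglongrightarrow> x"
    proof -
      have "(\<lambda>n. z n i) \<longlonglongrightarrow> x i" for i
      proof -
        have "(\<lambda>n. a * r n) \<longlonglongrightarrow> 0" for a
          unfolding r_def
          by (rule tendsto_mult_right_zero[OF LIMSEQ_Suc[OF LIMSEQ_inverse_real_of_nat]])
        from tendsto_add[OF tendsto_const this] show ?thesis
          unfolding z_def by (cases "i < d \<and> i \<notin> I") auto
      qed
      then have "limitin (product_topology (\<lambda>i. euclidean) UNIV) z x sequentially"
        unfolding limitin_componentwise by simp
      then show ?thesis by (simp add: euclidean_product_topology)
    qed
    ultimately show "x \<in> closure ?R" unfolding closure_sequential by blast
  qed
  show thesis
  proof (rule that[of h \<delta>])
    show "x \<in> closure ?R \<longleftrightarrow> (\<exists>b. restr (pdiff x w) h b)"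
      if "x \<in> Rn d" "\<And>i. i \<in> I \<Longrightarrow> x i = v i" "x \<in> open_box d w \<delta>" for x
      using that by (rule main)
  qed (rule h_read \<delta> h_ro)+
qed

theorem proposition4p2:
  fixes d k :: nat and P F :: "(nat \<Rightarrow> real) set" and I :: "nat set" and l :: "nat \<Rightarrow> real"
  assumes "generic_orthotope d P"
    and "k \<le> d"
    and "polytope_face d P k F"
    and "I \<subseteq> {..<d}" and "d - card I = k" and "F \<subseteq> gen_hyperplane d I l"
  shows "generic_orthotope k (forget d I ` F)"
proof -
  note P = assms(1)
  note cP = generic_orthotopeD(1)[OF P] and lP = generic_orthotopeD(2)[OF P]
  obtain v where v: "v \<in> P" "region_degree d (genericity_region d P v) = k"
    and F: "F = closure (genericity_region d P v)"
    using assms(3) unfolding polytope_face_def by blast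
  have FP: "F \<subseteq> P" unfolding F by (rule closure_genericity_region_subset[OF cP])
  have FR: "F \<subseteq> Rn d" using FP lP unfolding locally_conic_def by blast
  have vR: "v \<in> Rn d" using v(1) lP unfolding locally_conic_def by blast
  \<comment> \<open>The given hyperplane is forced: it can freeze only essential coordinates, and
    the degree makes their numbers equal.\<close>
  have I: "I = dep (local_fun d P v)"
  proof (rule card_subset_eq)
    obtain \<delta> where g: "germ d P v (local_fun d P v) \<delta>" using locally_conic_germ[OF lP v(1)] .
    have sub: "dep (local_fun d P v) \<subseteq> {..<d}" using dep_subset[OF germD(1)[OF g]] .
    then show "finite (dep (local_fun d P v))" using finite_subset by blast
    show "I \<subseteq> dep (local_fun d P v)"
      using assms(6) closure_subset unfolding F
      by (intro genericity_region_hyperplane[OF lP v(1) assms(4)]) blast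
    have "card I \<le> d" "card (dep (local_fun d P v)) \<le> d"
      using card_mono[OF finite_lessThan assms(4)] card_mono[OF finite_lessThan sub] by simp_all
    then show "card I = card (dep (local_fun d P v))"
      using v(2) region_degree_eq[OF lP v(1)] assms(5) by linarith
  qed
  have FI: "x i = v i" if "x \<in> F" "i \<in> I" for x i
    using closure_genericity_region_const[OF lP v(1)] that unfolding F I by blast

  \<comment> \<open>The enumeration of the free coordinates used by \<open>forget\<close>, with
    inverse \<open>p\<close>.\<close>
  define q where "q = (\<lambda>j. sorted_list_of_set ({..<d} - I) ! j)"
  have cardk: "card ({..<d} - I) = k"
    using assms(4,5) by (simp add: card_Diff_subset finite_subset[OF assms(4)])
  have q: "bij_betw q {..<k} ({..<d} - I)"
    unfolding q_def using bij_betw_nth[of "sorted_list_of_set ({..<d} - I)"] cardk by simp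
  define p where "p = inv_into {..<k} q"
  have p: "bij_betw p ({..<d} - I) {..<k}" unfolding p_def by (rule bij_betw_inv_into[OF q])
  have qp: "q (p i) = i" if "i \<in> {..<d} - I" for i
    unfolding p_def using bij_betw_inv_into_right[OF q that] .
  have pq: "p (q j) = j" if "j < k" for j
    unfolding p_def using bij_betw_inv_into_left[OF q] that by simp
  have qd: "q j \<in> {..<d} - I" if "j < k" for j using bij_betwE[OF q] that by simp
  have pk: "p i < k" if "i \<in> {..<d} - I" for i using bij_betwE[OF p] that by simp
  have forget: "forget d I x = (\<lambda>j. if j < k then x (q j) else 0)" for x
    unfolding forget_def cardk q_def ..
  \<comment> \<open>The face is constant in the coordinates of \<open>I\<close>, so filling in those
    of \<open>v\<close> inverts \<open>forget\<close> on it. From \<open>d\<close> on,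
    \<open>v\<close> supplies the zeros required by \<open>Rn d\<close>.\<close>
  define lift where "lift = (\<lambda>u :: nat \<Rightarrow> real. \<lambda>i. if i \<in> {..<d} - I then u (p i) else v i)"
  have lift_forget: "lift (forget d I x) = x" if x: "x \<in> F" for x
  proof
    fix i
    show "lift (forget d I x) i = x i"
      using FI[OF x, of i] FR x vR qp[of i] pk[of i] unfolding lift_def forget Rn_def
      by (cases "i < d") auto
  qed
  have forget_lift: "forget d I (lift u) = u" if "u \<in> Rn k" for u
    using that qd pq unfolding lift_def forget Rn_def by (auto simp: fun_eq_iff)
  have mem: "u \<in> forget d I ` F \<longleftrightarrow> lift u \<in> F" if u: "u \<in> Rn k" for u
  proof
    assume "u \<in> forget d I ` F"
    then obtain x where "x \<in> F" "u = forget d I x" by blast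
    then show "lift u \<in> F" using lift_forget[of x] by simp
  next
    assume "lift u \<in> F"
    then show "u \<in> forget d I ` F"
      using forget_lift[OF u] image_eqI[of u "forget d I" "lift u" F] by simp
  qed
  have FRk: "forget d I x \<in> Rn k" for x unfolding forget Rn_def by simp
  have liftR: "lift u \<in> Rn d" for u using vR unfolding lift_def Rn_def by simp

  \<comment> \<open>The function at \<open>u\<close> is the one from \<open>face_local\<close> after
    renumbering the free coordinates.\<close>
  have local: "\<exists>f \<delta>. germ k (forget d I ` F) u f \<delta> \<and> (f = (\<lambda>_. True) \<or> (\<exists>c A. read_once c A f))"
    if u: "u \<in> forget d I ` F" for u
  proof -
    obtain w where w: "w \<in> F" "u = forget d I w" using u by blast
    obtain h \<delta> where h: "reads ({..<d} - I) h" "0 < \<delta>"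
      and ro: "h = (\<lambda>_. True) \<or> (\<exists>c A. A \<subseteq> {..<d} - I \<and> read_once c A h)"
      and loc: "\<And>x. x \<in> Rn d \<Longrightarrow> (\<And>i. i \<in> I \<Longrightarrow> x i = v i) \<Longrightarrow> x \<in> open_box d w \<delta> \<Longrightarrow>
        x \<in> F \<longleftrightarrow> (\<exists>b. restr (pdiff x w) h b)"
      using face_local[OF P v(1) I w(1)[unfolded F]] unfolding F by metis
    define h' where "h' = (\<lambda>b. h (\<lambda>i. b (p i)))"
    \<comment> \<open>Half the radius, because \<open>germ\<close> uses a closed cube and
      \<open>face_local\<close> an open box.\<close>
    have "germ k (forget d I ` F) u h' (\<delta> / 2)"
      unfolding germ_def
    proof (intro conjI ballI impI)
      show "reads {..<k} h'"
        unfolding reads_def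
      proof (intro allI impI)
        fix b b' :: "nat \<Rightarrow> bool" assume "\<forall>i\<in>{..<k}. b i = b' i"
        then show "h' b = h' b'" unfolding h'_def using pk by (intro readsD[OF h(1)]) simp
      qed
      show "0 < \<delta> / 2" using h(2) by simp
      show "u \<in> Rn k" using w(2) FRk by simp
      fix x assume x: "x \<in> Rn k" "\<forall>i<k. \<bar>x i - u i\<bar> \<le> \<delta> / 2"
      have d: "lift x i - w i = x (p i) - u (p i)" if "i \<in> {..<d} - I" for i
        using that pk[OF that] qp[OF that] unfolding w(2) forget lift_def by simp
      have dp: "pdiff (lift x) w i = pdiff x u (p i)" if "i \<in> {..<d} - I" for i
        using d[OF that] unfolding pdiff_def .
      have d0: "lift x i - w i = 0" if "i \<in> I" for i
        using FI[OF w(1) that] that unfolding lift_def by simp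
      have "\<bar>lift x i - w i\<bar> < \<delta>" if "i < d" for i
      proof (cases "i \<in> I")
        case True
        then show ?thesis using d0 h(2) by simp
      next
        case False
        then have i: "i \<in> {..<d} - I" using that by simp
        have "\<bar>x (p i) - u (p i)\<bar> \<le> \<delta> / 2" using x(2) pk[OF i] by blast
        then show ?thesis using d[OF i] h(2) by simp
      qed
      then have "lift x \<in> open_box d w \<delta>" unfolding open_box_def by blast
      then have "x \<in> forget d I ` F \<longleftrightarrow> (\<exists>b. restr (pdiff (lift x) w) h b)"
        unfolding mem[OF x(1)] by (intro loc liftR) (simp add: lift_def)
      also have "\<dots> \<longleftrightarrow> (\<exists>b. restr (pdiff x u) h' b)"
      proof
        assume "\<exists>b. restr (pdiff (lift x) w) h b"
        then obtain b where b: "h (signfix (pdiff (lift x) w) b)" unfolding restr_def by blast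
        have "h (\<lambda>i. signfix (pdiff x u) (\<lambda>j. b (q j)) (p i)) = h (signfix (pdiff (lift x) w) b)"
          by (rule readsD[OF h(1)]) (simp add: signfix_def dp qp)
        then show "\<exists>b. restr (pdiff x u) h' b" using b unfolding restr_def h'_def by blast
      next
        assume "\<exists>b. restr (pdiff x u) h' b"
        then obtain b
          where b: "h (\<lambda>i. signfix (pdiff x u) b (p i))" unfolding restr_def h'_def by blast
        have "h (signfix (pdiff (lift x) w) (\<lambda>i. b (p i))) = h (\<lambda>i. signfix (pdiff x u) b (p i))"
          by (rule readsD[OF h(1)]) (simp add: signfix_def dp)
        then show "\<exists>b. restr (pdiff (lift x) w) h b" using b unfolding restr_def by blast
      qed
      finally show "x \<in> forget d I ` F \<longleftrightarrow> (\<exists>b. restr (pdiff x u) h' b)" .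
    qed
    moreover have "h' = (\<lambda>_. True) \<or> (\<exists>c A. read_once c A h')"
      using ro
    proof
      assume "\<exists>c A. A \<subseteq> {..<d} - I \<and> read_once c A h"
      then obtain c A where A: "A \<subseteq> {..<d} - I" "read_once c A h" by blast
      have "inj_on p A" using p A(1) inj_on_subset unfolding bij_betw_def by blast
      from read_once_reindex[OF A(2) this] show ?thesis unfolding h'_def by blast
    qed (simp add: h'_def)
    ultimately show ?thesis by blast
  qed

  have lF: "locally_conic k (forget d I ` F)" unfolding locally_conic_def using FRk local by blast
  have "compact F"
    using cP FP unfolding F by (metis closed_closure compact_Int_closed inf.absorb_iff2)
  moreover have "continuous_on F (forget d I)"
  proof (rule continuous_on_coordinatewise_then_product)
    fix j
    have "continuous_on F (\<lambda>x. x (q j))"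
      by (rule continuous_on_subset[OF continuous_on_product_coordinates subset_UNIV])
    then show "continuous_on F (\<lambda>x. forget d I x j)" unfolding forget by (cases "j < k") simp_all
  qed
  ultimately have "compact (forget d I ` F)" by (metis compact_continuous_image)
  then have "pure_orthogonal_polytope k (forget d I ` F)"
    using lF pure_orthogonal_polytope_iff by blast
  moreover have "floral_vertex k (tangent_cone k (forget d I ` F) u)"
    if s: "singular_point k (forget d I ` F) u" for u
  proof -
    have u: "u \<in> forget d I ` F" and dk: "dep (local_fun k (forget d I ` F) u) = {..<k}"
      using s singular_point_iff[OF lF] by blast+
    obtain f \<delta> where g: "germ k (forget d I ` F) u f \<delta>"
      and f: "f = (\<lambda>_. True) \<or> (\<exists>c A. read_once c A f)" using local[OF u] by blast
    have fk: "dep f = {..<k}" using dk local_fun_eq[OF g] by simp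
    have "floral_vertex k (sign_cone k f)"
      using f
    proof
      \<comment> \<open>A constant has no essential sign, so it occurs at a singular point only in
        dimension 0.\<close>
      assume t: "f = (\<lambda>_. True)"
      then have "{..<k} = {}" using fk by (simp add: dep_def)
      then have "k = 0" by (cases k) auto
      then show ?thesis using floral_vertex_0 t by simp
    next
      assume "\<exists>c A. read_once c A f"
      then obtain c A where A: "read_once c A f" by blast
      then have "A = {..<k}" using read_once_dep fk by metis
      then show ?thesis using A read_once_floral_vertex by blast
    qed
    then show ?thesis using tangent_cone_eq[OF g] by simp
  qed
  ultimately show ?thesis unfolding generic_orthotope_def by blast
qed

end
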